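(* Let $(v(x,t),\rho(x,t))$ be a smooth solution on $\mathbb{R}^n\times[0,T)$, $n=2,3$, $T\in(0,\infty]$, of the Euler equations for isentropic fluid flows $$\rho\frac{\partial v}{\partial t}+\rho(v\cdot\nabla)v=-\nabla p,\qquad\frac{\partial\rho}{\partial t}+\operatorname{div}(\rho v)=0,\qquad v(x,0)=v_0(x),\quad \rho(x,0)=\rho_0(x),$$ and let $\{X(\cdot,t)\}$ be the particle trajectory map generated by $v$. Let $\omega=\operatorname{curl}v$ be the vorticity, with initial vorticity $\omega_0$. Let $\gamma_0(s)$ be a vortex line for the initial vorticity $\omega_0$, and set $\gamma(s,t)=X(\gamma_0(s),t)$, which is also a vortex line by the Helmholtz theorem. Then the following is invariant along the trajectories of the vortex lines: $$\frac{|\omega(\gamma(s,t),t)|}{|\rho(\gamma(s,t),t)|\left|\frac{\partial\gamma(s,t)}{\partial s}\right|}=\frac{|\omega_0(\gamma_0(s))|}{|\rho_0(\gamma_0(s))|\left|\frac{\partial\gamma_0(s)}{\partial s}\right|}.$$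
   Context: $v=(v_1,\dots,v_n)$ is the velocity of the flow, $\rho=\rho(x,t)$ the mass density, $p=p(x,t)$ the scalar pressure, and $v_0,\rho_0$ are the given initial velocity and density; the homogeneous incompressible Euler equations correspond to $\rho\equiv$ const. The particle trajectory map $X(\cdot,t)$ generated by $v$ is defined by $\frac{\partial X(a,t)}{\partial t}=v(X(a,t),t)$, $X(a,0)=a\in\mathbb{R}^n$; for each $t\in[0,T)$ it is a diffeomorphism. A vortex line is an integral curve of the vorticity, understood up to reparametrization: $\{\gamma_0(s)\}_{s\in I}$ is an integral curve of a vector field $V$ if there is $f(s)\neq0$ for all $s\in I$ with $\frac{\partial\gamma_0(s)}{\partial s}=f(s)V(\gamma_0(s))$. *)

theory Defs
  imports "HOL-Analysis.Analysis"
begin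

section \<open>Smoothness\<close>

text \<open>Derivatives are taken within the set, so that on space-time \<open>\<real>\<^sup>n \<times> [0,T)\<close> the derivatives at
  \<open>t = 0\<close> are one-sided. All sets used below are convex with nonempty interior, so the derivative
  is unique there.\<close>

primrec C_k_on :: "nat \<Rightarrow> 'a::euclidean_space set \<Rightarrow> ('a \<Rightarrow> 'b::real_normed_vector) \<Rightarrow> bool" where
  "C_k_on 0 S f \<longleftrightarrow> continuous_on S f"
| "C_k_on (Suc k) S f \<longleftrightarrow>
     (\<exists>f'. (\<forall>x\<in>S. (f has_derivative f' x) (at x within S)) \<and> (\<forall>h. C_k_on k S (\<lambda>x. f' x h)))"

definition smooth_on :: "'a::euclidean_space set \<Rightarrow> ('a \<Rightarrow> 'b::real_normed_vector) \<Rightarrow> bool" where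
  "smooth_on S f \<longleftrightarrow> (\<forall>k. C_k_on k S f)"

definition diffeomorphism :: "('a::euclidean_space \<Rightarrow> 'a) \<Rightarrow> bool" where
  "diffeomorphism f \<longleftrightarrow> bij f \<and> smooth_on UNIV f \<and> smooth_on UNIV (inv f)"

section \<open>Differential operators\<close>

definition partial :: "'n \<Rightarrow> (real^'n::finite \<Rightarrow> 'b::real_normed_vector) \<Rightarrow> real^'n \<Rightarrow> 'b" where
  "partial i f x = frechet_derivative f (at x) (axis i 1)"

definition gradient :: "(real^'n::finite \<Rightarrow> real) \<Rightarrow> real^'n \<Rightarrow> real^'n" where
  "gradient f x = (\<chi> i. partial i f x)"

definition divergence :: "(real^'n::finite \<Rightarrow> real^'n) \<Rightarrow> real^'n \<Rightarrow> real" where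
  "divergence F x = (\<Sum>i\<in>UNIV. partial i (\<lambda>y. F y $ i) x)"

definition convective :: "real^'n::finite \<Rightarrow> (real^'n \<Rightarrow> real^'n) \<Rightarrow> real^'n \<Rightarrow> real^'n" where
  \<comment> \<open>\<open>(u \<cdot> \<nabla>)F\<close>\<close>
  "convective u F x = (\<Sum>j\<in>UNIV. u $ j *\<^sub>R partial j F x)"

definition curl :: "(real^3 \<Rightarrow> real^3) \<Rightarrow> real^3 \<Rightarrow> real^3" where
  "curl F x = vector
     [partial 2 (\<lambda>y. F y $ 3) x - partial 3 (\<lambda>y. F y $ 2) x,
      partial 3 (\<lambda>y. F y $ 1) x - partial 1 (\<lambda>y. F y $ 3) x,
      partial 1 (\<lambda>y. F y $ 2) x - partial 2 (\<lambda>y. F y $ 1) x]"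

section \<open>The Euler equations and the particle trajectory map\<close>

definition time_dom :: "ereal \<Rightarrow> real set" where
  "time_dom T = {t. 0 \<le> t \<and> ereal t < T}"

definition time_deriv :: "ereal \<Rightarrow> ('a \<Rightarrow> real \<Rightarrow> 'b::real_normed_vector) \<Rightarrow> 'a \<Rightarrow> real \<Rightarrow> 'b" where
  "time_deriv T f x t = vector_derivative (\<lambda>s. f x s) (at t within time_dom T)"

text \<open>The flow is isentropic: the pressure is a function \<open>P\<close> of the density alone. Neither
  regularity of \<open>P\<close> nor positivity of \<open>\<rho>\<close> is required; the pressure only has to be
  differentiable in space, so that its gradient makes sense.\<close>

definition isentropic_euler_solution ::
  "ereal \<Rightarrow> (real^'n::finite \<Rightarrow> real \<Rightarrow> real^'n) \<Rightarrow> (real^'n \<Rightarrow> real \<Rightarrow> real) \<Rightarrow> (real^'n \<Rightarrow> real \<Rightarrow> real)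
     \<Rightarrow> (real^'n \<Rightarrow> real^'n) \<Rightarrow> (real^'n \<Rightarrow> real) \<Rightarrow> bool" where
  "isentropic_euler_solution T v \<rho> p v\<^sub>0 \<rho>\<^sub>0 \<longleftrightarrow>
     smooth_on (UNIV \<times> time_dom T) (\<lambda>(x, t). v x t) \<and>
     smooth_on (UNIV \<times> time_dom T) (\<lambda>(x, t). \<rho> x t) \<and>
     (\<forall>t\<in>time_dom T. (\<lambda>x. p x t) differentiable_on UNIV) \<and>
     (\<exists>P :: real \<Rightarrow> real. \<forall>x. \<forall>t\<in>time_dom T. p x t = P (\<rho> x t)) \<and>
     (\<forall>x. \<forall>t\<in>time_dom T.
        \<rho> x t *\<^sub>R time_deriv T v x t + \<rho> x t *\<^sub>R convective (v x t) (\<lambda>y. v y t) x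
          = - gradient (\<lambda>y. p y t) x) \<and>
     (\<forall>x. \<forall>t\<in>time_dom T.
        time_deriv T \<rho> x t + divergence (\<lambda>y. \<rho> y t *\<^sub>R v y t) x = 0) \<and>
     (\<forall>x. v x 0 = v\<^sub>0 x) \<and> (\<forall>x. \<rho> x 0 = \<rho>\<^sub>0 x)"

definition particle_trajectory_map ::
  "ereal \<Rightarrow> (real^'n::finite \<Rightarrow> real \<Rightarrow> real^'n) \<Rightarrow> (real^'n \<Rightarrow> real \<Rightarrow> real^'n) \<Rightarrow> bool" where
  "particle_trajectory_map T v X \<longleftrightarrow>
     (\<forall>a. X a 0 = a) \<and>
     (\<forall>a. \<forall>t\<in>time_dom T.
        ((\<lambda>s. X a s) has_vector_derivative v (X a t) t) (at t within time_dom T)) \<and>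
     (\<forall>t\<in>time_dom T. diffeomorphism (\<lambda>a. X a t))"

section \<open>Vortex lines\<close>

text \<open>Integral curves up to reparametrization, on a nondegenerate interval \<open>I\<close> of any kind
  (open, half-open, closed, bounded or not).\<close>

definition integral_curve :: "(real^3 \<Rightarrow> real^3) \<Rightarrow> (real \<Rightarrow> real^3) \<Rightarrow> real set \<Rightarrow> bool" where
  "integral_curve V \<gamma> I \<longleftrightarrow> is_interval I \<and> interior I \<noteq> {} \<and>
     (\<exists>f. \<forall>s\<in>I. f s \<noteq> 0 \<and> (\<gamma> has_vector_derivative f s *\<^sub>R V (\<gamma> s)) (at s within I))"

text \<open>The quotient \<open>|\<omega>| / (|\<rho>| |\<partial>\<gamma>/\<partial>s|)\<close> at the parameter \<open>s\<close>, for a curve \<open>\<gamma>\<close> on \<open>I\<close>.\<close>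

definition vortex_ratio ::
  "(real^3 \<Rightarrow> real^3) \<Rightarrow> (real^3 \<Rightarrow> real) \<Rightarrow> (real \<Rightarrow> real^3) \<Rightarrow> real set \<Rightarrow> real \<Rightarrow> real" where
  "vortex_ratio \<omega> \<rho> \<gamma> I s =
     norm (\<omega> (\<gamma> s)) / (\<bar>\<rho> (\<gamma> s)\<bar> * norm (vector_derivative \<gamma> (at s within I)))"

section \<open>Planar flows\<close>

text \<open>The vorticity of a planar velocity is perpendicular to the plane, so vortex lines of a planar
  flow live in \<open>\<real>\<^sup>3\<close>, where the flow is extended independently of \<open>x\<^sub>3\<close> and with zero third velocity
  component: the velocity is \<open>(v\<^sub>1, v\<^sub>2, 0)\<close>, the vorticity
  \<open>(0, 0, \<partial>\<^sub>1v\<^sub>2 - \<partial>\<^sub>2v\<^sub>1)\<close>, and particles keep their third coordinate.\<close>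

definition horizontal :: "real^3 \<Rightarrow> real^2" where
  "horizontal x = vector [x $ 1, x $ 2]"

definition planar_vorticity :: "(real^2 \<Rightarrow> real^2) \<Rightarrow> real^3 \<Rightarrow> real^3" where
  "planar_vorticity F x = vector
     [0, 0, partial 1 (\<lambda>y. F y $ 2) (horizontal x) - partial 2 (\<lambda>y. F y $ 1) (horizontal x)]"

definition planar_density :: "(real^2 \<Rightarrow> real) \<Rightarrow> real^3 \<Rightarrow> real" where
  "planar_density \<rho> x = \<rho> (horizontal x)"

definition planar_map :: "(real^2 \<Rightarrow> real^2) \<Rightarrow> real^3 \<Rightarrow> real^3" where
  "planar_map Y x = vector [Y (horizontal x) $ 1, Y (horizontal x) $ 2, x $ 3]"

end

theory Submission
  imports Defs
begin

text \<open>Along particle paths the vorticity 2-form \<open>DV h \<bullet> k - DV k \<bullet> h\<close> obeys a linear equation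
  wherever \<open>\<rho> \<noteq> 0\<close>: the material acceleration is \<open>-\<nabla>p/\<rho>\<close>, which is curl-free because \<open>\<nabla>p\<close> is
  parallel to \<open>\<nabla>\<rho>\<close>. Together with the continuity equation, which also keeps \<open>\<rho>\<close> from vanishing,
  this says that \<open>W = \<omega>/\<rho>\<close> solves \<open>W' = Dv W\<close> in space, and that \<open>\<omega>/\<rho>\<close> is constant in the plane.
  In space a Gronwall estimate identifies \<open>W(t)\<close> with \<open>DX W(0)\<close>. So \<open>DX\<close> maps \<open>\<gamma>\<^sub>0' = f \<omega>\<^sub>0\<close> to
  \<open>f (\<rho>\<^sub>0/\<rho>) \<omega>\<close>, and the factor cancels in the ratio. In the plane vortex lines are vertical and
  only the constancy of \<open>\<omega>/\<rho>\<close> is needed.\<close>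

section \<open>Second derivatives and level sets\<close>

text \<open>Write \<open>J\<close> for the spatial derivative of \<open>v\<close> and beta(h,k) = Jh
  . k - Jk . h. The linear equation along a particle is beta'(h,k) = - beta(Jh,k) - beta(h,Jk): beta
  is carried by the flow, as is the mass form \<rho> dx. In space \<omega>/\<rho> is the vector
  field whose contraction with the mass form is beta, so it is carried too, which explains why no
  divergence term survives in its equation. In the plane beta is a multiple of the mass form, and
  that multiple stays constant. Two obstacles shape the argument. Since \<open>P\<close> may be
  irregular, there is no enthalpy whose gradient is the acceleration; parallel gradients must be
  obtained from level sets. And \<open>p\<close> is only assumed differentiable, so its second
  derivatives have to be read off the momentum equation. Symmetry of second derivatives is used at
  interior points of space-time, hence for t > 0; the initial time enters through continuity on the
  closed time interval.\<close>

lemma second_difference_estimate: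
  fixes f :: "'a::real_normed_vector \<Rightarrow> real"
  assumes "open S" "x \<in> S" and f': "\<And>y. y \<in> S \<Longrightarrow> (f has_derivative f' y) (at y)"
    and A: "((\<lambda>y. f' y h) has_derivative A) (at x)" and "0 < e"
  shows "\<exists>d>0. \<forall>s. 0 < s \<and> s < d \<longrightarrow>
    \<bar>f (x + s *\<^sub>R h + s *\<^sub>R k) - f (x + s *\<^sub>R h) - f (x + s *\<^sub>R k) + f x - s\<^sup>2 * A k\<bar> \<le> e * s\<^sup>2"
proof -
  \<comment> \<open>\<open>s * c\<close> bounds all displacements in the parallelogram spanned by
    \<open>s *\<^sub>R h\<close> and \<open>s *\<^sub>R k\<close>. With \<open>e'\<close> chosen
    below, two linearization errors \<open>e' * (s * c)\<close> add up to
    \<open>e * s\<close>.\<close>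
  define c where "c = norm h + norm k + 1"
  have c: "c > 0" by (simp add: c_def add_nonneg_pos)
  define e' where "e' = e / (2 * c)"
  have e': "e' > 0" using c \<open>0 < e\<close> by (simp add: e'_def)
  obtain r where r: "r > 0" "ball x r \<subseteq> S"
    using assms(1,2) open_contains_ball by blast
  obtain d where d: "d > 0"
    "\<And>y. norm (y - x) < d \<Longrightarrow> \<bar>f' y h - f' x h - A (y - x)\<bar> \<le> e' * norm (y - x)"
    using A e' unfolding has_derivative_at_alt by (metis real_norm_def)
  have linA: "linear A" using A by (rule has_derivative_linear)
  define d' where "d' = min d r / c"
  have "\<bar>f (x + s *\<^sub>R h + s *\<^sub>R k) - f (x + s *\<^sub>R h) - f (x + s *\<^sub>R k) + f x - s\<^sup>2 * A k\<bar> \<le> e * s\<^sup>2"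
    if s: "0 < s" "s < d'" for s
  proof -
    have sc: "s * c < d" "s * c < r"
      using s c by (auto simp: d'_def field_simps)
    have near: "norm (u *\<^sub>R h + w *\<^sub>R k) \<le> s * c" if "0 \<le> u" "u \<le> s" "0 \<le> w" "w \<le> s" for u w
    proof -
      have "norm (u *\<^sub>R h + w *\<^sub>R k) \<le> u * norm h + w * norm k"
        using that by (intro norm_triangle_le) simp
      also have "\<dots> \<le> s * norm h + s * norm k"
        using that by (intro add_mono mult_right_mono) auto
      also have "\<dots> \<le> s * c" using s by (simp add: c_def algebra_simps)
      finally show ?thesis .
    qed
    have inS: "x + u *\<^sub>R h + w *\<^sub>R k \<in> S" if "0 \<le> u" "u \<le> s" "0 \<le> w" "w \<le> s" for u w
    proof -
      have "x + (u *\<^sub>R h + w *\<^sub>R k) \<in> ball x r"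
        using near[OF that] sc by (subst mem_ball, subst dist_commute) (simp add: dist_norm)
      then show ?thesis using r by (auto simp: add.assoc)
    qed
    \<comment> \<open>The second difference is the increment of \<open>\<phi>\<close> over
      \<open>[0,s]\<close>. The mean value theorem leaves two values of \<open>f' _ h\<close>, both
      compared with the linearization at \<open>x\<close>; their base points differ by
      \<open>s *\<^sub>R k\<close>, hence the term \<open>s * A k\<close>.\<close>
    define \<phi> where "\<phi> u = f (x + u *\<^sub>R h + s *\<^sub>R k) - f (x + u *\<^sub>R h)" for u
    have "\<exists>\<xi>\<in>{0<..<s}. \<phi> s - \<phi> 0
        = (\<lambda>y. f' (x + \<xi> *\<^sub>R h + s *\<^sub>R k) (y *\<^sub>R h) - f' (x + \<xi> *\<^sub>R h) (y *\<^sub>R h)) (s - 0)"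
    proof (rule mvt_simple[OF s(1)])
      fix u assume u: "0 \<le> u" "u \<le> s"
      have line: "((\<lambda>u. x + u *\<^sub>R h + z) has_derivative (\<lambda>y. y *\<^sub>R h)) (at u within {0..s})" for z
        by (auto intro!: derivative_eq_intros)
      have "((\<lambda>u. f (x + u *\<^sub>R h + s *\<^sub>R k)) has_derivative (\<lambda>y. f' (x + u *\<^sub>R h + s *\<^sub>R k) (y *\<^sub>R h)))
          (at u within {0..s})"
        by (rule has_derivative_compose[OF line]) (use u s in \<open>auto intro!: f' inS\<close>)
      moreover have "((\<lambda>u. f (x + u *\<^sub>R h)) has_derivative (\<lambda>y. f' (x + u *\<^sub>R h) (y *\<^sub>R h)))
          (at u within {0..s})"
        by (rule has_derivative_compose[OF line[where z = 0, simplified]])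
          (use inS[of u 0] u s in \<open>auto intro!: f'\<close>)
      ultimately show "(\<phi> has_derivative (\<lambda>y. f' (x + u *\<^sub>R h + s *\<^sub>R k) (y *\<^sub>R h) - f' (x + u *\<^sub>R h) (y *\<^sub>R h)))
          (at u within {0..s})"
        unfolding \<phi>_def by (rule has_derivative_diff)
    qed
    then obtain \<xi> where \<xi>: "0 < \<xi>" "\<xi> < s"
      and eq: "\<phi> s - \<phi> 0 = f' (x + \<xi> *\<^sub>R h + s *\<^sub>R k) (s *\<^sub>R h) - f' (x + \<xi> *\<^sub>R h) (s *\<^sub>R h)"
      by auto
    have sub: "f' y (s *\<^sub>R h) = s * f' y h" if "y \<in> S" for y
      using linear_cmul[OF has_derivative_linear[OF f'[OF that]]] by simp
    have eq': "\<phi> s - \<phi> 0 = s * (f' (x + \<xi> *\<^sub>R h + s *\<^sub>R k) h - f' (x + \<xi> *\<^sub>R h) h)"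
      using eq sub inS[of \<xi> s] inS[of \<xi> 0] \<xi> s by (simp add: algebra_simps)
    let ?a = "f' (x + \<xi> *\<^sub>R h + s *\<^sub>R k) h" and ?b = "f' (x + \<xi> *\<^sub>R h) h"
    have n1: "norm (\<xi> *\<^sub>R h + s *\<^sub>R k) \<le> s * c" and n2: "norm (\<xi> *\<^sub>R h) \<le> s * c"
      using near[of \<xi> s] near[of \<xi> 0] \<xi> s by auto
    have "\<bar>?a - f' x h - A (\<xi> *\<^sub>R h + s *\<^sub>R k)\<bar> \<le> e' * norm (\<xi> *\<^sub>R h + s *\<^sub>R k)"
      using d(2)[of "x + \<xi> *\<^sub>R h + s *\<^sub>R k"] n1 sc by (simp add: add.assoc)
    also have "\<dots> \<le> e' * (s * c)" using n1 e' by simp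
    finally have 1: "\<bar>?a - f' x h - A (\<xi> *\<^sub>R h + s *\<^sub>R k)\<bar> \<le> e' * (s * c)" .
    have "\<bar>?b - f' x h - A (\<xi> *\<^sub>R h)\<bar> \<le> e' * norm (\<xi> *\<^sub>R h)"
      using d(2)[of "x + \<xi> *\<^sub>R h"] n2 sc by simp
    also have "\<dots> \<le> e' * (s * c)" using n2 e' by simp
    finally have 2: "\<bar>?b - f' x h - A (\<xi> *\<^sub>R h)\<bar> \<le> e' * (s * c)" .
    have "A (\<xi> *\<^sub>R h + s *\<^sub>R k) = A (\<xi> *\<^sub>R h) + s * A k"
      using linA by (simp add: linear_add linear_cmul)
    with 1 2 have "\<bar>?a - ?b - s * A k\<bar> \<le> 2 * (e' * (s * c))" by linarith
    also have "\<dots> = e * s" using c by (simp add: e'_def)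
    finally have "s * \<bar>?a - ?b - s * A k\<bar> \<le> s * (e * s)"
      using s by (intro mult_left_mono) auto
    moreover have "s * \<bar>?a - ?b - s * A k\<bar> = \<bar>\<phi> s - \<phi> 0 - s\<^sup>2 * A k\<bar>"
      using s by (simp add: eq' abs_mult_pos' power2_eq_square algebra_simps)
    ultimately show ?thesis
      by (simp add: \<phi>_def power2_eq_square algebra_simps)
  qed
  moreover have "d' > 0" using d r c by (simp add: d'_def)
  ultimately show ?thesis by blast
qed

text \<open>The second difference is unchanged when \<open>h\<close> and \<open>k\<close> are
  exchanged, so its quotient by \<open>s\<^sup>2\<close> approximates both \<open>A k\<close> and
  \<open>B h\<close>. The directional derivatives are differentiated at \<open>x\<close> alone,
  which suits the pressure.\<close>

lemma symmetric_second_derivative: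
  fixes f :: "'a::real_normed_vector \<Rightarrow> real"
  assumes S: "open S" "x \<in> S" and f': "\<And>y. y \<in> S \<Longrightarrow> (f has_derivative f' y) (at y)"
    and A: "((\<lambda>y. f' y h) has_derivative A) (at x)"
    and B: "((\<lambda>y. f' y k) has_derivative B) (at x)"
  shows "A k = B h"
proof -
  have "\<bar>A k - B h\<bar> \<le> 0 + e" if "e > 0" for e
  proof -
    have e2: "e / 2 > 0" using that by simp
    obtain d1 where d1: "d1 > 0" "\<And>s. 0 < s \<and> s < d1 \<Longrightarrow>
        \<bar>f (x + s *\<^sub>R h + s *\<^sub>R k) - f (x + s *\<^sub>R h) - f (x + s *\<^sub>R k) + f x - s\<^sup>2 * A k\<bar> \<le> e / 2 * s\<^sup>2"
      using second_difference_estimate[OF S f' A e2, where k = k] by blast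
    obtain d2 where d2: "d2 > 0" "\<And>s. 0 < s \<and> s < d2 \<Longrightarrow>
        \<bar>f (x + s *\<^sub>R k + s *\<^sub>R h) - f (x + s *\<^sub>R k) - f (x + s *\<^sub>R h) + f x - s\<^sup>2 * B h\<bar> \<le> e / 2 * s\<^sup>2"
      using second_difference_estimate[OF S f' B e2, where k = h] by blast
    define s where "s = min d1 d2 / 2"
    have s: "0 < s" "s < d1" "s < d2" using d1(1) d2(1) by (auto simp: s_def)
    have "x + s *\<^sub>R k + s *\<^sub>R h = x + s *\<^sub>R h + s *\<^sub>R k" by simp
    then have "\<bar>s\<^sup>2 * A k - s\<^sup>2 * B h\<bar> \<le> e / 2 * s\<^sup>2 + e / 2 * s\<^sup>2"
      using d1(2)[of s] d2(2)[of s] s by (smt (verit))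
    also have "s\<^sup>2 * A k - s\<^sup>2 * B h = s\<^sup>2 * (A k - B h)" by (simp add: algebra_simps)
    finally have "s\<^sup>2 * \<bar>A k - B h\<bar> \<le> s\<^sup>2 * e"
      by (simp add: abs_mult mult.commute)
    then show ?thesis using s by simp
  qed
  then have "\<bar>A k - B h\<bar> \<le> 0" by (rule field_le_epsilon)
  then show ?thesis by simp
qed

text \<open>Near a regular point of \<open>\<rho>\<close> the intermediate value theorem along the transversal \<open>n\<close> finds
  points of the level set of \<open>\<rho>\<close> within \<open>o(s)\<close> of \<open>x + s h\<close>; this replaces the implicit function
  theorem, so \<open>P\<close> may be arbitrary.\<close>

lemma derivative_level_tangent:
  fixes \<rho> p :: "'a::real_normed_vector \<Rightarrow> real"
  assumes \<rho>: "(\<rho> has_derivative r) (at x)" and p: "(p has_derivative q) (at x)"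
    and cont: "continuous_on UNIV \<rho>"
    and P: "\<And>y. p y = P (\<rho> y)"
    and "r h = 0" "r n \<noteq> 0"
  shows "q h = 0"
proof -
  \<comment> \<open>Rescaled so that \<open>r m = 1\<close>: a move by \<open>u\<close> along
    \<open>m\<close> changes \<open>\<rho>\<close> by \<open>u\<close> to first order.\<close>
  define m where "m = (1 / r n) *\<^sub>R n"
  have linr: "linear r" and linq: "linear q"
    using \<rho> p by (auto intro: has_derivative_linear)
  have rm: "r m = 1" using \<open>r n \<noteq> 0\<close> by (simp add: m_def linear_cmul[OF linr])
  have "\<bar>q h\<bar> \<le> e * (\<bar>q m\<bar> + 1)" if e: "e > 0" for e
  proof -
    define c where "c = norm h + e * norm m + 1"
    have c: "c > 0" using e by (simp add: c_def add_nonneg_pos)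
    \<comment> \<open>Makes both expansion errors at most \<open>e * s / 2\<close> for
      \<open>\<bar>u\<bar> \<le> e * s\<close>; at the two extreme values of \<open>u\<close> this
      fixes the sign of the change of \<open>\<rho>\<close>.\<close>
    define e1 where "e1 = e / (2 * c)"
    have e1: "e1 > 0" using c e by (simp add: e1_def)
    obtain d1 where d1: "d1 > 0" "\<And>y. norm (y - x) < d1 \<Longrightarrow> \<bar>\<rho> y - \<rho> x - r (y - x)\<bar> \<le> e1 * norm (y - x)"
      using \<rho> e1 unfolding has_derivative_at_alt by (metis real_norm_def)
    obtain d2 where d2: "d2 > 0" "\<And>y. norm (y - x) < d2 \<Longrightarrow> \<bar>p y - p x - q (y - x)\<bar> \<le> e1 * norm (y - x)"
      using p e1 unfolding has_derivative_at_alt by (metis real_norm_def)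
    define s where "s = min d1 d2 / (2 * c)"
    have s: "s > 0" "s * c < d1" "s * c < d2" using d1(1) d2(1) c by (auto simp: s_def field_simps)
    have near: "norm (s *\<^sub>R h + u *\<^sub>R m) \<le> s * c" if "\<bar>u\<bar> \<le> e * s" for u
    proof -
      have "norm (s *\<^sub>R h + u *\<^sub>R m) \<le> s * norm h + \<bar>u\<bar> * norm m"
        using s by (intro norm_triangle_le) simp
      also have "\<dots> \<le> s * norm h + e * s * norm m"
        using that by (intro add_mono mult_right_mono) auto
      also have "\<dots> \<le> s * c" using s by (simp add: c_def algebra_simps)
      finally show ?thesis .
    qed
    have e1sc: "e1 * (s * c) = e * s / 2" using c by (simp add: e1_def)
    have \<rho>est: "\<bar>\<rho> (x + s *\<^sub>R h + u *\<^sub>R m) - \<rho> x - u\<bar> \<le> e * s / 2" if "\<bar>u\<bar> \<le> e * s" for u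
    proof -
      have "r (s *\<^sub>R h + u *\<^sub>R m) = u"
        using rm \<open>r h = 0\<close> by (simp add: linear_add[OF linr] linear_cmul[OF linr])
      then have "\<bar>\<rho> (x + s *\<^sub>R h + u *\<^sub>R m) - \<rho> x - u\<bar> \<le> e1 * norm (s *\<^sub>R h + u *\<^sub>R m)"
        using d1(2)[of "x + s *\<^sub>R h + u *\<^sub>R m"] near[OF that] s by (simp add: add.assoc)
      also have "\<dots> \<le> e1 * (s * c)" using near[OF that] e1 by simp
      finally show ?thesis using e1sc by simp
    qed
    have es: "e * s > 0" using e s by simp
    have "\<exists>u\<ge>- (e * s). u \<le> e * s \<and> \<rho> (x + s *\<^sub>R h + u *\<^sub>R m) = \<rho> x"
    proof (rule IVT')
      show "\<rho> (x + s *\<^sub>R h + (- (e * s)) *\<^sub>R m) \<le> \<rho> x" "\<rho> x \<le> \<rho> (x + s *\<^sub>R h + (e * s) *\<^sub>R m)"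
        using \<rho>est[of "- (e * s)"] \<rho>est[of "e * s"] es by linarith+
      show "continuous_on {- (e * s)..e * s} (\<lambda>u. \<rho> (x + s *\<^sub>R h + u *\<^sub>R m))"
        by (intro continuous_on_compose2[OF cont] continuous_intros) auto
    qed (use es in simp)
    then obtain u where u: "\<bar>u\<bar> \<le> e * s" "\<rho> (x + s *\<^sub>R h + u *\<^sub>R m) = \<rho> x"
      by force
    \<comment> \<open>On the level set \<open>p\<close> keeps its value, so its expansion bounds
      \<open>s * q h + u * q m\<close> by a multiple of \<open>e * s\<close>; as \<open>u\<close> is
      of the same size, so is \<open>s * q h\<close>.\<close>
    have "p (x + s *\<^sub>R h + u *\<^sub>R m) = p x" by (simp only: P u(2))
    then have "\<bar>q (s *\<^sub>R h + u *\<^sub>R m)\<bar> \<le> e1 * norm (s *\<^sub>R h + u *\<^sub>R m)"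
      using d2(2)[of "x + s *\<^sub>R h + u *\<^sub>R m"] near[OF u(1)] s by (simp add: add.assoc)
    also have "\<dots> \<le> e1 * (s * c)" using near[OF u(1)] e1 by simp
    finally have "\<bar>s * q h + u * q m\<bar> \<le> e * s"
      using e1sc es by (simp add: linear_add[OF linq] linear_cmul[OF linq])
    moreover have "\<bar>u * q m\<bar> \<le> e * s * \<bar>q m\<bar>"
      using u(1) by (simp add: abs_mult mult_right_mono)
    ultimately have "\<bar>s * q h\<bar> \<le> e * s + e * s * \<bar>q m\<bar>" by linarith
    then have "s * \<bar>q h\<bar> \<le> s * (e * (\<bar>q m\<bar> + 1))"
      using s by (simp add: abs_mult algebra_simps)
    then show ?thesis using s by simp
  qed
  note est = this
  have "\<bar>q h\<bar> \<le> 0 + e" if "e > 0" for e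
    using est[of "e / (\<bar>q m\<bar> + 1)"] that by (simp add: add_nonneg_pos)
  then have "\<bar>q h\<bar> \<le> 0" by (rule field_le_epsilon)
  then show ?thesis by simp
qed

text \<open>The combination \<open>r h *\<^sub>R k - r k *\<^sub>R h\<close> lies in the kernel of
  \<open>r\<close>, so it is tangent to the level set. If \<open>r\<close> vanishes in both
  directions, both sides are zero.\<close>

lemma parallel_derivatives:
  fixes \<rho> p :: "'a::real_normed_vector \<Rightarrow> real"
  assumes \<rho>: "(\<rho> has_derivative r) (at x)" and p: "(p has_derivative q) (at x)"
    and cont: "continuous_on UNIV \<rho>" and P: "\<And>y. p y = P (\<rho> y)"
  shows "r h * q k = r k * q h"
proof (cases "r h = 0 \<and> r k = 0")
  case False
  then obtain n where n: "r n \<noteq> 0" by blast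
  have lin: "linear r" "linear q" using \<rho> p by (auto intro: has_derivative_linear)
  have "r (r h *\<^sub>R k - r k *\<^sub>R h) = 0"
    using lin by (simp add: linear_diff linear_cmul)
  then have "q (r h *\<^sub>R k - r k *\<^sub>R h) = 0"
    using derivative_level_tangent[OF \<rho> p cont P _ n] by blast
  then show ?thesis using lin by (simp add: linear_diff linear_cmul)
qed auto

section \<open>Gronwall estimates and the derivative of a flow\<close>

text \<open>The differential inequality is only assumed below the barrier \<open>r\<close>, which the solution never reaches.\<close>

lemma gronwall_barrier:
  fixes \<phi> :: "real \<Rightarrow> real"
  assumes cont: "continuous_on {0..t0} \<phi>" and "0 \<le> t0" "0 \<le> \<phi> 0" "0 \<le> K"
    and der: "\<And>t. 0 < t \<Longrightarrow> t < t0 \<Longrightarrow> (\<phi> has_real_derivative \<phi>' t) (at t)"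
    and le: "\<And>t. 0 < t \<Longrightarrow> t < t0 \<Longrightarrow> \<phi> t < r \<Longrightarrow> \<phi>' t \<le> K * \<phi> t"
    and small: "\<phi> 0 * exp (K * t0) < r"
  shows "\<phi> t0 \<le> \<phi> 0 * exp (K * t0)"
proof -
  have bound: "\<phi> t1 \<le> \<phi> 0 * exp (K * t1)"
    if t1: "0 \<le> t1" "t1 \<le> t0" and lt: "\<And>t. 0 < t \<Longrightarrow> t < t1 \<Longrightarrow> \<phi> t < r" for t1
  proof -
    have "\<phi> 0 * exp (- K * 0) \<ge> \<phi> t1 * exp (- K * t1)"
    proof (rule DERIV_nonpos_imp_decreasing_open[OF t1(1)])
      fix t assume t: "0 < t" "t < t1"
      have "((\<lambda>t. \<phi> t * exp (- K * t)) has_real_derivative (\<phi>' t - K * \<phi> t) * exp (- K * t)) (at t)"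
        using t t1 by (auto intro!: derivative_eq_intros der simp: algebra_simps)
      moreover have "(\<phi>' t - K * \<phi> t) * exp (- K * t) \<le> 0"
        using le[of t] lt[of t] t t1 by (intro mult_nonpos_nonneg) auto
      ultimately show "\<exists>y. ((\<lambda>t. \<phi> t * exp (- K * t)) has_real_derivative y) (at t) \<and> y \<le> 0" by blast
    next
      show "continuous_on {0..t1} (\<lambda>t. \<phi> t * exp (- K * t))"
        using t1 by (intro continuous_intros continuous_on_subset[OF cont]) auto
    qed
    then show ?thesis by (simp add: exp_minus field_simps)
  qed
  have "\<phi> t < r" if "0 < t" "t < t0" for t
  proof (rule ccontr)
    assume nlt: "\<not> \<phi> t < r"
    \<comment> \<open>Times at which the barrier is met. Before the first one,
      \<open>\<tau>\<close>, the differential inequality holds, so \<open>bound\<close> at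
      \<open>\<tau>\<close> contradicts \<open>small\<close>.\<close>
    let ?Z = "{t\<in>{0..t0}. r \<le> \<phi> t}"
    have "closed ?Z"
      using continuous_on_closed_Collect_le[OF continuous_on_const cont] by simp
    then have "compact ?Z"
      by (auto simp: compact_eq_bounded_closed intro: bounded_subset[of "{0..t0}"])
    moreover have "t \<in> ?Z" using nlt that by auto
    then have "?Z \<noteq> {}" by blast
    ultimately have "\<exists>\<tau>\<in>?Z. \<forall>t\<in>?Z. \<tau> \<le> t" by (rule compact_attains_inf)
    then obtain \<tau> where \<tau>: "\<tau> \<in> ?Z" and first: "\<forall>t\<in>?Z. \<tau> \<le> t" by (rule bexE)
    have "\<phi> t < r" if "0 < t" "t < \<tau>" for t
    proof (rule ccontr)
      assume "\<not> \<phi> t < r"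
      then have "t \<in> ?Z" using that \<tau> by auto
      then show False using bspec[OF first] that by fastforce
    qed
    then have "\<phi> \<tau> \<le> \<phi> 0 * exp (K * \<tau>)"
      using \<tau> by (intro bound) auto
    also have "\<dots> \<le> \<phi> 0 * exp (K * t0)"
      using assms \<tau> by (intro mult_left_mono) (auto intro: mult_left_mono)
    finally show False using small \<tau> by auto
  qed
  then show ?thesis using bound[of t0] \<open>0 \<le> t0\<close> by simp
qed

lemma norm_power2_has_derivative:
  fixes u :: "real \<Rightarrow> 'a::real_inner"
  assumes "(u has_vector_derivative u') (at t)"
  shows "((\<lambda>t. (norm (u t))\<^sup>2) has_real_derivative 2 * (u t \<bullet> u')) (at t)"
  using assms unfolding power2_norm_eq_inner has_vector_derivative_def has_field_derivative_def
  by (auto intro!: derivative_eq_intros simp: inner_commute)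

text \<open>Backward Gronwall estimate: the squared norm decays at most at rate
  \<open>2 * C\<close>, so its product with \<open>exp (2 * C * t)\<close> cannot decrease from a
  positive value to zero. The square avoids the kink of the norm at the origin.\<close>

lemma gronwall_nonvanishing:
  fixes u :: "real \<Rightarrow> 'a::real_inner"
  assumes cont: "continuous_on {0..t0} u" and "0 \<le> t0"
    and der: "\<And>t. 0 < t \<Longrightarrow> t < t0 \<Longrightarrow> (u has_vector_derivative u' t) (at t)"
    and le: "\<And>t. 0 < t \<Longrightarrow> t < t0 \<Longrightarrow> norm (u' t) \<le> C * norm (u t)"
    and "u 0 \<noteq> 0"
  shows "u t0 \<noteq> 0"
proof -
  have "(norm (u 0))\<^sup>2 * exp (2 * C * 0) \<le> (norm (u t0))\<^sup>2 * exp (2 * C * t0)"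
  proof (rule DERIV_nonneg_imp_increasing_open[OF \<open>0 \<le> t0\<close>])
    fix t assume t: "0 < t" "t < t0"
    have "((\<lambda>t. (norm (u t))\<^sup>2 * exp (2 * C * t)) has_real_derivative
        (2 * (u t \<bullet> u' t) + 2 * C * (norm (u t))\<^sup>2) * exp (2 * C * t)) (at t)"
      by (rule derivative_eq_intros norm_power2_has_derivative der refl t)+ (simp add: algebra_simps)
    moreover have "\<bar>u t \<bullet> u' t\<bar> \<le> norm (u t) * (C * norm (u t))"
      by (rule order_trans[OF Cauchy_Schwarz_ineq2]) (use le[OF t] in \<open>intro mult_left_mono, auto\<close>)
    then have "(2 * (u t \<bullet> u' t) + 2 * C * (norm (u t))\<^sup>2) * exp (2 * C * t) \<ge> 0"
      by (intro mult_nonneg_nonneg) (auto simp: power2_eq_square algebra_simps)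
    ultimately show "\<exists>y. ((\<lambda>t. (norm (u t))\<^sup>2 * exp (2 * C * t)) has_real_derivative y) (at t) \<and> 0 \<le> y"
      by blast
  next
    show "continuous_on {0..t0} (\<lambda>t. (norm (u t))\<^sup>2 * exp (2 * C * t))"
      by (intro continuous_intros cont)
  qed
  with \<open>u 0 \<noteq> 0\<close> show ?thesis by (auto simp: power2_eq_square mult_le_0_iff)
qed

text \<open>The sum over the basis stands in for the operator norm because it depends continuously
  on a parameter as soon as each \<open>f b\<close> does.\<close>

lemma norm_le_sum_Basis:
  fixes f :: "'a::euclidean_space \<Rightarrow> 'b::real_normed_vector"
  assumes "bounded_linear f"
  shows "norm (f x) \<le> (\<Sum>b\<in>Basis. norm (f b)) * norm x"
  using onorm[OF assms] onorm_componentwise[OF assms]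
  by (meson mult_right_mono norm_ge_zero order_trans)

text \<open>On a compact tube around the path the derivative varies uniformly little, and the mean
  value inequality turns this into an error bound. The radius is the same for all times, so a single
  step size will serve the whole interval.\<close>

lemma uniform_linearization:
  fixes f :: "'a::euclidean_space \<Rightarrow> real \<Rightarrow> 'b::real_normed_vector"
  assumes der: "\<And>y t. t \<in> {0..t0} \<Longrightarrow> ((\<lambda>y. f y t) has_derivative D y t) (at y)"
    and cont: "\<And>h. continuous_on (UNIV \<times> {0..t0}) (\<lambda>(y, t). D y t h)"
    and x: "continuous_on {0..t0} x" and "e > 0"
  obtains d where "d > 0" "\<And>t w. t \<in> {0..t0} \<Longrightarrow> norm w \<le> d \<Longrightarrow>
    norm (f (x t + w) t - f (x t) t - D (x t) t w) \<le> e * norm w"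
proof -
  \<comment> \<open>Bounds the operator norm of the change of \<open>D\<close> from the path to the
    displacement \<open>w\<close>. It is zero at \<open>w = 0\<close> for every time, so its uniform
    continuity gives a radius valid for all \<open>t\<close>.\<close>
  define N where "N = (\<lambda>(w, t). \<Sum>b\<in>Basis. norm (D (x t + w) t b - D (x t) t b))"
  define K where "K = cball (0::'a) 1 \<times> {0..t0}"
  have c1: "continuous_on K (\<lambda>z. D (x (snd z) + fst z) (snd z) b)" for b
  proof -
    have "continuous_on K (\<lambda>z. (x (snd z) + fst z, snd z))"
      by (auto simp: K_def intro!: continuous_intros continuous_on_compose2[OF x])
    then show ?thesis
      using continuous_on_compose2[OF cont[of b]] by (force simp: K_def)
  qed
  have c2: "continuous_on K (\<lambda>z. D (x (snd z)) (snd z) b)" for b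
  proof -
    have "continuous_on K (\<lambda>z. (x (snd z), snd z))"
      by (auto simp: K_def intro!: continuous_intros continuous_on_compose2[OF x])
    then show ?thesis
      using continuous_on_compose2[OF cont[of b]] by (force simp: K_def)
  qed
  have "continuous_on K N"
    unfolding N_def split_def by (intro continuous_intros c1 c2)
  moreover have "compact K" by (simp add: K_def compact_Times)
  ultimately have "uniformly_continuous_on K N" by (rule compact_uniformly_continuous)
  then obtain d where d: "d > 0" "\<And>z z'. z \<in> K \<Longrightarrow> z' \<in> K \<Longrightarrow> dist z' z < d \<Longrightarrow> dist (N z') (N z) < e"
    using \<open>e > 0\<close> unfolding uniformly_continuous_on_def by metis
  define d1 where "d1 = min 1 (d / 2)"
  have d1: "d1 > 0" "d1 \<le> 1" "d1 < d" using d(1) by (auto simp: d1_def)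
  have Nle: "N (w, t) \<le> e" if "t \<in> {0..t0}" "norm w \<le> d1" for t w
  proof -
    have "dist (N (w, t)) (N (0, t)) < e"
      using that d1 by (intro d(2)) (auto simp: K_def dist_Pair_Pair)
    moreover have "N (0, t) = 0" by (simp add: N_def)
    ultimately show ?thesis by (simp add: dist_real_def)
  qed
  show ?thesis
  proof (rule that[OF d1(1)])
    fix t w assume t: "t \<in> {0..t0}" and w: "norm (w::'a) \<le> d1"
    have "norm (f (x t + w) t - f (x t) t - D (x t) t (x t + w - x t)) \<le> norm (x t + w - x t) * e"
    proof (rule differentiable_bound_linearization[where S = "cball (x t) d1" and f' = "\<lambda>y. D y t" and f = "\<lambda>y. f y t"])
      fix s :: real assume "s \<in> {0..1}"
      then have "\<bar>s\<bar> * norm w \<le> 1 * d1"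
        using w by (intro mult_mono) auto
      then show "x t + s *\<^sub>R (x t + w - x t) \<in> cball (x t) d1" by (simp add: dist_norm)
    next
      fix y assume y: "y \<in> cball (x t) d1"
      show "((\<lambda>y. f y t) has_derivative D y t) (at y within cball (x t) d1)"
        using der[OF t] by (rule has_derivative_at_withinI)
      have "bounded_linear (D y t - D (x t) t)"
        unfolding fun_diff_def
        by (intro bounded_linear_sub has_derivative_bounded_linear[OF der[OF t]])
      then have "onorm (D y t - D (x t) t) \<le> (\<Sum>b\<in>Basis. norm ((D y t - D (x t) t) b))"
        by (rule onorm_componentwise)
      also have "\<dots> = N (y - x t, t)" by (simp add: N_def)
      also have "\<dots> \<le> e"
        using y by (intro Nle t) (simp add: dist_norm norm_minus_commute)
      finally show "onorm (D y t - D (x t) t) \<le> e" .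
    qed (use d1 in auto)
    then show "norm (f (x t + w) t - f (x t) t - D (x t) t w) \<le> e * norm w"
      by (simp add: mult.commute)
  qed
qed

lemma continuous_on_interval_bound:
  fixes g :: "real \<Rightarrow> 'b::real_normed_vector"
  assumes "continuous_on {a..b} g"
  obtains B where "B \<ge> 0" "\<And>t. t \<in> {a..b} \<Longrightarrow> norm (g t) \<le> B"
proof -
  have "bounded (g ` {a..b})"
    by (intro compact_imp_bounded compact_continuous_image assms compact_Icc)
  then obtain B where "\<And>t. t \<in> {a..b} \<Longrightarrow> norm (g t) \<le> B"
    unfolding bounded_iff by blast
  then show ?thesis by (intro that[of "max B 0"]) (auto simp: max.coboundedI1)
qed

text \<open>The difference quotient of the flow minus \<open>W\<close> satisfies a Gronwall inequality as long as it
  stays in the unit ball, with inhomogeneity tending to \<open>0\<close>. Neither joint smoothness of the flow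
  nor solvability of the linearized equation enters, since \<open>W\<close> is given.\<close>

lemma flow_derivative_along_path:
  fixes v :: "'a::euclidean_space \<Rightarrow> real \<Rightarrow> 'a"
  assumes "0 \<le> t0"
    and der: "\<And>y t. t \<in> {0..t0} \<Longrightarrow> ((\<lambda>y. v y t) has_derivative D y t) (at y)"
    and cont: "\<And>h. continuous_on (UNIV \<times> {0..t0}) (\<lambda>(y, t). D y t h)"
    and X: "\<And>b t. t \<in> {0..t0} \<Longrightarrow> (X b has_vector_derivative v (X b t) t) (at t within {0..t0})"
    and X0: "\<And>b. X b 0 = b"
    and Wc: "continuous_on {0..t0} W"
    and W: "\<And>t. 0 < t \<Longrightarrow> t < t0 \<Longrightarrow> (W has_vector_derivative D (X a t) t (W t)) (at t)"
    and A: "((\<lambda>b. X b t0) has_derivative A) (at a)"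
  shows "A (W 0) = W t0"
proof -
  have Xc: "continuous_on {0..t0} (X b)" for b
    unfolding continuous_on_eq_continuous_within by (blast intro: has_vector_derivative_continuous X)
  have X': "(X b has_vector_derivative v (X b t) t) (at t)" if "0 < t" "t < t0" for b t
    using X[of t b] that by (simp add: at_within_Icc_at)
  have linD: "bounded_linear (D y t)" if "t \<in> {0..t0}" for y t
    using der[OF that] by (rule has_derivative_bounded_linear)
  have "continuous_on {0..t0} (\<lambda>t. D (X a t) t b)" for b
  proof -
    have "continuous_on {0..t0} (\<lambda>t. (X a t, t))" by (intro continuous_intros Xc)
    then show ?thesis using continuous_on_compose2[OF cont[of b]] by force
  qed
  then have "continuous_on {0..t0} (\<lambda>t. \<Sum>b\<in>Basis. norm (D (X a t) t b))"
    by (intro continuous_intros)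
  then obtain L where L: "L \<ge> 0" "\<And>t. t \<in> {0..t0} \<Longrightarrow> norm (\<Sum>b\<in>Basis. norm (D (X a t) t b)) \<le> L"
    by (rule continuous_on_interval_bound) blast
  have DL: "norm (D (X a t) t w) \<le> L * norm w" if "t \<in> {0..t0}" for t w
    by (rule order_trans[OF norm_le_sum_Basis[OF linD[OF that]]])
      (use L(2)[OF that] in \<open>auto intro!: mult_right_mono\<close>)
  obtain B where B: "B \<ge> 0" "\<And>t. t \<in> {0..t0} \<Longrightarrow> norm (W t) \<le> B"
    using continuous_on_interval_bound[OF Wc] by blast
  \<comment> \<open>Gronwall factor for the squared error: \<open>2 * L\<close> comes from the
    linear term, the extra \<open>1\<close> from
    \<open>2 * (norm u * c) \<le> (norm u)\<^sup>2 + c\<^sup>2\<close>.\<close>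
  define E where "E = exp ((2 * L + 1) * t0)"
  have E: "E > 0" by (simp add: E_def)
  have main: "\<exists>s0>0. \<forall>s. 0 < s \<and> s < s0 \<longrightarrow>
      norm ((1 / s) *\<^sub>R (X (a + s *\<^sub>R W 0) t0 - X a t0) - W t0) < \<epsilon>" if \<epsilon>: "\<epsilon> > 0" for \<epsilon>
  proof -
    \<comment> \<open>The smaller of the barrier \<open>1\<close> and the squared target accuracy.
      The choice of \<open>c\<close> gives \<open>c\<^sup>2 * E = m / 2\<close>, strictly below
      both.\<close>
    define m where "m = min 1 (\<epsilon>\<^sup>2)"
    have m: "m > 0" "m \<le> 1" "m \<le> \<epsilon>\<^sup>2" using \<epsilon> by (auto simp: m_def)
    define c where "c = sqrt (m / (2 * E))"
    have c: "c > 0" using m E by (simp add: c_def)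
    have c2: "c\<^sup>2 = m / (2 * E)" using m E by (simp add: c_def)
    then have cE: "c\<^sup>2 * E < m" using m E by simp
    have "c / (B + 1) > 0" using c B by simp
    then obtain d where d: "d > 0" "\<And>t w. t \<in> {0..t0} \<Longrightarrow> norm w \<le> d \<Longrightarrow>
        norm (v (X a t + w) t - v (X a t) t - D (X a t) t w) \<le> c / (B + 1) * norm w"
      using uniform_linearization[OF der cont Xc] by blast
    \<comment> \<open>While the error \<open>u\<close> has norm at most \<open>1\<close>, the
      neighbouring particle is displaced by at most \<open>s * (B + 1)\<close>; the bound on
      \<open>s\<close> keeps it within the radius \<open>d\<close> of the linearization.\<close>
    have "norm ((1 / s) *\<^sub>R (X (a + s *\<^sub>R W 0) t0 - X a t0) - W t0) < \<epsilon>"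
      if s: "0 < s" "s < d / (B + 1)" for s
    proof -
      define u where "u t = (1 / s) *\<^sub>R (X (a + s *\<^sub>R W 0) t - X a t) - W t" for t
      define u' where "u' t = (1 / s) *\<^sub>R (v (X (a + s *\<^sub>R W 0) t) t - v (X a t) t) - D (X a t) t (W t)" for t
      have u0: "u 0 = 0" using s by (simp add: u_def X0)
      have der_u: "(u has_vector_derivative u' t) (at t)" if "0 < t" "t < t0" for t
        unfolding u_def u'_def
        by (intro has_vector_derivative_diff W that X'
            bounded_linear.has_vector_derivative[OF bounded_linear_scaleR_right])
      have est: "norm (u' t) \<le> L * norm (u t) + c" if t: "t \<in> {0..t0}" and u1: "norm (u t) \<le> 1" for t
      proof -
        define w where "w = s *\<^sub>R (W t + u t)"
        have Xw: "X (a + s *\<^sub>R W 0) t = X a t + w" using s by (simp add: w_def u_def)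
        have "norm (W t + u t) \<le> B + 1"
          using B(2)[OF t] u1 by (meson add_mono norm_triangle_le)
        then have nw: "norm w \<le> s * (B + 1)" using s by (simp add: w_def)
        also have "\<dots> \<le> d" using s B by (simp add: field_simps)
        finally have "norm (v (X a t + w) t - v (X a t) t - D (X a t) t w) \<le> c / (B + 1) * norm w"
          using d(2)[OF t] by blast
        also have "\<dots> \<le> c / (B + 1) * (s * (B + 1))"
          using nw c B by (intro mult_left_mono) auto
        also have "\<dots> = c * s" using B by simp
        finally have R: "norm (v (X a t + w) t - v (X a t) t - D (X a t) t w) \<le> c * s" .
        have "D (X a t) t w = s *\<^sub>R (D (X a t) t (W t) + D (X a t) t (u t))"
          using linD[OF t] by (simp add: w_def linear_simps)
        then have "u' t = D (X a t) t (u t) + (1 / s) *\<^sub>R (v (X a t + w) t - v (X a t) t - D (X a t) t w)"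
          using s by (simp add: u'_def Xw algebra_simps)
        also have "norm \<dots> \<le> L * norm (u t) + (1 / s) * (c * s)"
        proof (intro norm_triangle_le add_mono DL t)
          have "norm ((1 / s) *\<^sub>R z) \<le> (1 / s) * (c * s)" if "norm z \<le> c * s" for z :: 'a
            using that s by (simp add: field_simps)
          then show "norm ((1 / s) *\<^sub>R (v (X a t + w) t - v (X a t) t - D (X a t) t w)) \<le> (1 / s) * (c * s)"
            using R by blast
        qed
        finally show ?thesis using s by simp
      qed
      \<comment> \<open>Adding \<open>c\<^sup>2\<close> absorbs the inhomogeneity, so that a
        homogeneous Gronwall inequality applies; the initial value is just
        \<open>c\<^sup>2\<close>.\<close>
      have "(norm (u t0))\<^sup>2 + c\<^sup>2 \<le> ((norm (u 0))\<^sup>2 + c\<^sup>2) * exp ((2 * L + 1) * t0)"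
      proof (rule gronwall_barrier[where r = 1 and \<phi>' = "\<lambda>t. 2 * (u t \<bullet> u' t)"])
        show "continuous_on {0..t0} (\<lambda>t. (norm (u t))\<^sup>2 + c\<^sup>2)"
          unfolding u_def by (intro continuous_intros Xc Wc)
        show "((norm (u 0))\<^sup>2 + c\<^sup>2) * exp ((2 * L + 1) * t0) < 1"
          using cE m by (simp add: u0 E_def)
      next
        fix t assume t: "0 < t" "t < t0"
        show "((\<lambda>t. (norm (u t))\<^sup>2 + c\<^sup>2) has_real_derivative 2 * (u t \<bullet> u' t)) (at t)"
          using DERIV_add[OF norm_power2_has_derivative[OF der_u[OF t]] DERIV_const[of "c\<^sup>2"]] by simp
        assume lt: "(norm (u t))\<^sup>2 + c\<^sup>2 < 1"
        have "(norm (u t))\<^sup>2 \<le> 1\<^sup>2" using lt by (smt (verit) zero_le_power2 one_power2)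
        then have "norm (u t) \<le> 1" by (rule power2_le_imp_le) simp
        then have "u t \<bullet> u' t \<le> norm (u t) * (L * norm (u t) + c)"
          using est[of t] t norm_cauchy_schwarz[of "u t" "u' t"]
          by (meson atLeastAtMost_iff less_imp_le mult_left_mono norm_ge_zero order_trans)
        moreover have "2 * (norm (u t) * c) \<le> (norm (u t))\<^sup>2 + c\<^sup>2"
          using sum_squares_bound[of "norm (u t)" c] by simp
        moreover have "0 \<le> 2 * (L * c\<^sup>2)" using L by simp
        ultimately show "2 * (u t \<bullet> u' t) \<le> (2 * L + 1) * ((norm (u t))\<^sup>2 + c\<^sup>2)"
          by (simp add: power2_eq_square algebra_simps)
      qed (use L \<open>0 \<le> t0\<close> in auto)
      then have "(norm (u t0))\<^sup>2 + c\<^sup>2 \<le> c\<^sup>2 * E"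
        by (simp add: u0 E_def)
      then have "(norm (u t0))\<^sup>2 < \<epsilon>\<^sup>2"
        using cE m(3) by (smt (verit) zero_le_power2)
      then have "norm (u t0) < \<epsilon>" using \<epsilon> power2_less_imp_less by fastforce
      then show ?thesis by (simp add: u_def)
    qed
    moreover have "d / (B + 1) > 0" using d B by simp
    ultimately show ?thesis by blast
  qed
  \<comment> \<open>The same difference quotient approximates \<open>W t0\<close> by
    \<open>main\<close> and \<open>A (W 0)\<close> by differentiability of the flow map;
    \<open>\<epsilon>\<close> shares \<open>e\<close> between the two errors.\<close>
  have "norm (A (W 0) - W t0) \<le> 0 + e" if e: "e > 0" for e
  proof -
    define h where "h = W 0"
    define \<epsilon> where "\<epsilon> = e / (norm h + 1)"
    have h1: "norm h + 1 > 0" by (simp add: add_nonneg_pos)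
    have \<epsilon>: "\<epsilon> > 0" "\<epsilon> * (norm h + 1) = e"
      unfolding \<epsilon>_def using e h1 by (rule divide_pos_pos, use h1 in simp)
    obtain s0 where s0: "s0 > 0" "\<And>s. 0 < s \<Longrightarrow> s < s0 \<Longrightarrow>
        norm ((1 / s) *\<^sub>R (X (a + s *\<^sub>R h) t0 - X a t0) - W t0) < \<epsilon>"
      using main[OF \<epsilon>(1)] unfolding h_def by blast
    obtain d where d: "d > 0"
      "\<And>y. norm (y - a) < d \<Longrightarrow> norm (X y t0 - X a t0 - A (y - a)) \<le> \<epsilon> * norm (y - a)"
      using A \<epsilon> unfolding has_derivative_at_alt by blast
    define s where "s = min (s0 / 2) (d / (norm h + 1))"
    have "s \<le> s0 / 2" unfolding s_def by (rule min.cobounded1)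
    moreover have "s > 0" using s0(1) d(1) h1 by (simp add: s_def)
    ultimately have s: "s > 0" "s < s0" by linarith+
    have "s \<le> d / (norm h + 1)" unfolding s_def by (rule min.cobounded2)
    then have "s * (norm h + 1) \<le> d" using h1 by (simp add: pos_le_divide_eq)
    then have sh: "s * norm h < d" using s by (simp add: algebra_simps)
    define q where "q = (1 / s) *\<^sub>R (X (a + s *\<^sub>R h) t0 - X a t0)"
    have "s *\<^sub>R (q - A h) = X (a + s *\<^sub>R h) t0 - X a t0 - A (s *\<^sub>R h)"
      using s linear_cmul[OF has_derivative_linear[OF A]] by (simp add: q_def scaleR_diff_right)
    moreover have "norm (X (a + s *\<^sub>R h) t0 - X a t0 - A (s *\<^sub>R h)) \<le> \<epsilon> * (s * norm h)"
      using d(2)[of "a + s *\<^sub>R h"] sh s by simp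
    ultimately have "s * norm (q - A h) \<le> s * (\<epsilon> * norm h)"
      using s by (metis norm_scaleR abs_of_pos mult.left_commute)
    then have 1: "norm (q - A h) \<le> \<epsilon> * norm h" using s by simp
    have 2: "norm (q - W t0) < \<epsilon>" unfolding q_def by (rule s0(2)[OF s])
    have "norm (A h - W t0) \<le> norm (q - W t0) + norm (q - A h)"
      using norm_triangle_ineq4[of "q - W t0" "q - A h"] by simp
    then have "norm (A h - W t0) \<le> \<epsilon> * norm h + \<epsilon>" using 1 2 by linarith
    then show ?thesis using \<epsilon>(2) by (simp add: h_def algebra_simps)
  qed
  then have "norm (A (W 0) - W t0) \<le> 0" by (rule field_le_epsilon)
  then show ?thesis by simp
qed

section \<open>Material derivatives\<close>

lemma time_dom_Icc: "t \<in> time_dom T \<Longrightarrow> {0..t} \<subseteq> time_dom T"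
  by (auto simp: time_dom_def intro: le_less_trans[rotated])

lemma zero_in_time_dom: "0 < T \<Longrightarrow> 0 \<in> time_dom T"
  by (simp add: time_dom_def flip: zero_ereal_def)

lemma interior_time_dom:
  assumes "0 < t" "t \<in> time_dom T"
  shows "t \<in> interior (time_dom T)"
proof (rule interiorI)
  show "open {t. 0 < t \<and> ereal t < T}"
    by (intro open_Collect_conj open_Collect_less continuous_intros)
qed (use assms in \<open>auto simp: time_dom_def\<close>)

text \<open>Gives uniqueness of derivatives within an interval, endpoints included, so that
  \<open>vector_derivative\<close> returns the one that was computed. A set with interior is no
  singleton, and a connected set with more than one point is perfect.\<close>

lemma at_within_interval_neq_bot:
  fixes I :: "real set"
  assumes "is_interval I" "interior I \<noteq> {}" "t \<in> I"
  shows "at t within I \<noteq> bot"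
proof -
  have "I \<noteq> {x}" for x using assms(2) by auto
  then have "t islimpt I"
    using assms by (intro connected_imp_perfect) (auto simp: is_interval_connected)
  then show ?thesis by (simp add: trivial_limit_within)
qed

lemma at_within_time_dom_neq_bot:
  assumes "0 < T" "t \<in> time_dom T"
  shows "at t within time_dom T \<noteq> bot"
proof (rule at_within_interval_neq_bot)
  show "is_interval (time_dom T)"
    unfolding is_interval_1 time_dom_def
    by (auto intro: le_less_trans[of "ereal _" "ereal _" T])
  obtain t1 where "0 < ereal t1" "ereal t1 < T"
    using ereal_dense2[OF assms(1)] by auto
  then show "interior (time_dom T) \<noteq> {}"
    using interior_time_dom[of t1 T] by (auto simp: time_dom_def zero_ereal_def)
qed (rule assms)

text \<open>\<open>C_k_on\<close> only asserts existence at each order. Unfolding order two at once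
  makes \<open>f''\<close> differentiate the same \<open>f'\<close> that differentiates
  \<open>f\<close>.\<close>

lemma smooth_on_twice:
  assumes "smooth_on S f"
  obtains f' f'' where "\<And>z. z \<in> S \<Longrightarrow> (f has_derivative f' z) (at z within S)"
    "\<And>h z. z \<in> S \<Longrightarrow> ((\<lambda>z. f' z h) has_derivative f'' h z) (at z within S)"
proof -
  have "C_k_on (Suc (Suc 0)) S f" using assms unfolding smooth_on_def by blast
  then obtain f' where f': "\<forall>z\<in>S. (f has_derivative f' z) (at z within S)"
    and "\<forall>h. C_k_on (Suc 0) S (\<lambda>z. f' z h)"
    unfolding C_k_on.simps(2)[of "Suc 0"] by blast
  then have "\<forall>h. \<exists>g. \<forall>z\<in>S. ((\<lambda>z. f' z h) has_derivative g z) (at z within S)"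
    unfolding C_k_on.simps(2)[of 0] by blast
  then obtain f'' where "\<forall>h. \<forall>z\<in>S. ((\<lambda>z. f' z h) has_derivative f'' h z) (at z within S)"
    by metis
  then show ?thesis using f' that by blast
qed

text \<open>A product rule for a linear map whose differentiability is known one direction at a
  time: expanding the argument in the basis leaves a finite sum of ordinary products.\<close>

lemma has_derivative_apply_linear:
  fixes L :: "'a::real_normed_vector \<Rightarrow> 'b::euclidean_space \<Rightarrow> 'c::real_normed_vector"
  assumes S: "open S" "z \<in> S"
    and lin: "\<And>y. y \<in> S \<Longrightarrow> linear (L y)"
    and L: "\<And>b. ((\<lambda>y. L y b) has_derivative L' b) (at z)"
    and w: "(w has_derivative w') (at z)"
  shows "((\<lambda>y. L y (w y)) has_derivative
      (\<lambda>h. L z (w' h) + (\<Sum>b\<in>Basis. (w z \<bullet> b) *\<^sub>R L' b h))) (at z)"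
proof -
  have expand: "L y u = (\<Sum>b\<in>Basis. (u \<bullet> b) *\<^sub>R L y b)" if "y \<in> S" for y u
  proof -
    have "L y u = L y (\<Sum>b\<in>Basis. (u \<bullet> b) *\<^sub>R b)" by (simp add: euclidean_representation)
    also have "\<dots> = (\<Sum>b\<in>Basis. (u \<bullet> b) *\<^sub>R L y b)"
      using lin[OF that] by (simp add: linear_sum linear_cmul)
    finally show ?thesis .
  qed
  have "((\<lambda>y. \<Sum>b\<in>Basis. (w y \<bullet> b) *\<^sub>R L y b) has_derivative
      (\<lambda>h. \<Sum>b\<in>Basis. (w z \<bullet> b) *\<^sub>R L' b h + (w' h \<bullet> b) *\<^sub>R L z b)) (at z)"
    by (intro has_derivative_sum has_derivative_scaleR has_derivative_inner_left w L)
  moreover have "(\<Sum>b\<in>Basis. (w z \<bullet> b) *\<^sub>R L' b h + (w' h \<bullet> b) *\<^sub>R L z b)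
      = L z (w' h) + (\<Sum>b\<in>Basis. (w z \<bullet> b) *\<^sub>R L' b h)" for h
    unfolding sum.distrib expand[OF S(2), of "w' h"] by (rule add.commute)
  ultimately have "((\<lambda>y. \<Sum>b\<in>Basis. (w y \<bullet> b) *\<^sub>R L y b) has_derivative
      (\<lambda>h. L z (w' h) + (\<Sum>b\<in>Basis. (w z \<bullet> b) *\<^sub>R L' b h))) (at z)"
    by simp
  then show ?thesis
    by (rule has_derivative_transform_within_open[OF _ S]) (rule expand[symmetric])
qed

text \<open>\<open>V'\<close> and \<open>R'\<close> are the space-time derivatives of \<open>v\<close> and \<open>\<rho>\<close>; \<open>V'' h z\<close> is the derivative of
  \<open>z \<mapsto> V' z h\<close>.\<close>

locale lagrangian_flow =
  fixes T :: ereal and v :: "real^'n::finite \<Rightarrow> real \<Rightarrow> real^'n" and \<rho> p :: "real^'n \<Rightarrow> real \<Rightarrow> real"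
    and P :: "real \<Rightarrow> real" and X :: "real^'n \<Rightarrow> real \<Rightarrow> real^'n"
    and V' :: "(real^'n) \<times> real \<Rightarrow> (real^'n) \<times> real \<Rightarrow> real^'n"
    and V'' :: "(real^'n) \<times> real \<Rightarrow> (real^'n) \<times> real \<Rightarrow> (real^'n) \<times> real \<Rightarrow> real^'n"
    and R' :: "(real^'n) \<times> real \<Rightarrow> (real^'n) \<times> real \<Rightarrow> real"
  assumes T: "0 < T"
    and V': "\<And>z. z \<in> UNIV \<times> time_dom T \<Longrightarrow>
      ((\<lambda>(x, t). v x t) has_derivative V' z) (at z within UNIV \<times> time_dom T)"
    and V'': "\<And>h z. z \<in> UNIV \<times> time_dom T \<Longrightarrow>
      ((\<lambda>z. V' z h) has_derivative V'' h z) (at z within UNIV \<times> time_dom T)"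
    and R': "\<And>z. z \<in> UNIV \<times> time_dom T \<Longrightarrow>
      ((\<lambda>(x, t). \<rho> x t) has_derivative R' z) (at z within UNIV \<times> time_dom T)"
    and p: "\<And>t. t \<in> time_dom T \<Longrightarrow> (\<lambda>x. p x t) differentiable_on UNIV"
    and P: "\<And>x t. t \<in> time_dom T \<Longrightarrow> p x t = P (\<rho> x t)"
    and momentum: "\<And>x t. t \<in> time_dom T \<Longrightarrow>
      \<rho> x t *\<^sub>R time_deriv T v x t + \<rho> x t *\<^sub>R convective (v x t) (\<lambda>y. v y t) x
        = - gradient (\<lambda>y. p y t) x"
    and mass: "\<And>x t. t \<in> time_dom T \<Longrightarrow>
      time_deriv T \<rho> x t + divergence (\<lambda>y. \<rho> y t *\<^sub>R v y t) x = 0"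
    and X0: "\<And>a. X a 0 = a"
    and X: "\<And>a t. t \<in> time_dom T \<Longrightarrow>
      (X a has_vector_derivative v (X a t) t) (at t within time_dom T)"
begin

text \<open>The velocity gradient, taken as a slice of the space-time derivative so that its rate of
  change along a particle can be read off \<open>V''\<close>.\<close>

definition J :: "real^'n \<Rightarrow> real \<Rightarrow> real^'n \<Rightarrow> real^'n" where
  "J x t h = V' (x, t) (h, 0)"

lemma slice_derivative:
  assumes g: "\<And>z. z \<in> UNIV \<times> time_dom T \<Longrightarrow> (g has_derivative g' z) (at z within UNIV \<times> time_dom T)"
    and t: "t \<in> time_dom T"
  shows "((\<lambda>y. g (y, t)) has_derivative (\<lambda>h. g' (x, t) (h, 0))) (at x)"
  by (rule has_derivative_in_compose2[where t = "UNIV \<times> time_dom T" and g = g, OF g])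
    (use t in \<open>auto intro!: derivative_eq_intros\<close>)

text \<open>A particle moves through space-time with velocity \<open>(v, 1)\<close>, so this is the
  material derivative. Being taken within \<open>time_dom T\<close>, it also yields continuity at
  the initial time.\<close>

lemma path_derivative:
  assumes g: "\<And>z. z \<in> UNIV \<times> time_dom T \<Longrightarrow> (g has_derivative g' z) (at z within UNIV \<times> time_dom T)"
    and t: "t \<in> time_dom T"
  shows "((\<lambda>t. g (X a t, t)) has_vector_derivative g' (X a t, t) (v (X a t) t, 1)) (at t within time_dom T)"
proof -
  have "((\<lambda>t. (X a t, t)) has_derivative (\<lambda>y. y *\<^sub>R (v (X a t) t, 1))) (at t within time_dom T)"
    using has_vector_derivative_Pair[OF X[OF t] has_vector_derivative_id]
    by (simp add: has_vector_derivative_def)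
  then have "((\<lambda>t. g (X a t, t)) has_derivative (\<lambda>y. g' (X a t, t) (y *\<^sub>R (v (X a t) t, 1)))) (at t within time_dom T)"
    by (intro has_derivative_in_compose2[where t = "UNIV \<times> time_dom T" and g = g, OF g]) (use t in auto)
  moreover have "linear (g' (X a t, t))"
    using g[of "(X a t, t)"] t by (auto intro: has_derivative_linear)
  ultimately show ?thesis
    by (simp only: has_vector_derivative_def linear_cmul)
qed

lemma time_slice_derivative:
  assumes g: "\<And>z. z \<in> UNIV \<times> time_dom T \<Longrightarrow> (g has_derivative g' z) (at z within UNIV \<times> time_dom T)"
    and t: "t \<in> time_dom T"
  shows "vector_derivative (\<lambda>s. g (x, s)) (at t within time_dom T) = g' (x, t) (0, 1)"
proof (rule vector_derivative_within[OF at_within_time_dom_neq_bot[OF T t]])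
  have "((\<lambda>s. g (x, s)) has_derivative (\<lambda>y. g' (x, t) (y *\<^sub>R (0, 1)))) (at t within time_dom T)"
    by (rule has_derivative_in_compose2[where t = "UNIV \<times> time_dom T" and g = g, OF g])
      (use t in \<open>auto intro!: derivative_eq_intros\<close>)
  moreover have "linear (g' (x, t))"
    using g[of "(x, t)"] t by (auto intro: has_derivative_linear)
  ultimately show "((\<lambda>s. g (x, s)) has_vector_derivative g' (x, t) (0, 1)) (at t within time_dom T)"
    by (simp only: has_vector_derivative_def linear_cmul)
qed

lemma v_derivative: "t \<in> time_dom T \<Longrightarrow> ((\<lambda>y. v y t) has_derivative J x t) (at x)"
  using slice_derivative[OF V'] by (simp add: J_def[abs_def])

lemma linear_J: "t \<in> time_dom T \<Longrightarrow> linear (J x t)"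
  using has_derivative_linear[OF v_derivative] .

lemma J_continuous:
  assumes "t0 \<in> time_dom T"
  shows "continuous_on (UNIV \<times> {0..t0}) (\<lambda>(y, t). J y t h)"
proof (rule continuous_on_subset)
  show "continuous_on (UNIV \<times> time_dom T) (\<lambda>(y, t). J y t h)"
    unfolding J_def using has_derivative_continuous_on[OF V''] by (simp add: split_def)
qed (use time_dom_Icc[OF assms] in auto)

lemma X_derivative_Icc:
  assumes "t0 \<in> time_dom T" "t \<in> {0..t0}"
  shows "(X a has_vector_derivative v (X a t) t) (at t within {0..t0})"
  using X has_vector_derivative_within_subset time_dom_Icc assms by blast

lemma J_path_continuous: "continuous_on (time_dom T) (\<lambda>t. J (X a t) t h)"
proof -
  have "continuous_on (time_dom T) (\<lambda>t. V' (X a t, t) h)" for h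
    unfolding continuous_on_eq_continuous_within
    by (blast intro: has_vector_derivative_continuous path_derivative[OF V''])
  then show ?thesis by (simp add: J_def)
qed

lemma partial_v:
  assumes "t \<in> time_dom T"
  shows "partial i (\<lambda>y. v y t $ j) x = J x t (axis i 1) $ j"
proof -
  have "((\<lambda>y. v y t $ j) has_derivative (\<lambda>h. J x t h $ j)) (at x)"
    by (rule bounded_linear.has_derivative[OF bounded_linear_vec_nth v_derivative[OF assms]])
  then show ?thesis
    by (simp add: partial_def frechet_derivative_at[symmetric])
qed

lemma convective_v:
  assumes "t \<in> time_dom T"
  shows "convective u (\<lambda>y. v y t) x = J x t u"
proof -
  have "convective u (\<lambda>y. v y t) x = (\<Sum>j\<in>UNIV. u $ j *\<^sub>R J x t (axis j 1))"
    by (simp add: convective_def partial_def frechet_derivative_at[OF v_derivative[OF assms], symmetric])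
  also have "\<dots> = J x t (\<Sum>j\<in>UNIV. u $ j *\<^sub>R axis j 1)"
    using linear_J[OF assms] by (simp add: linear_sum linear_cmul)
  also have "(\<Sum>j\<in>UNIV. u $ j *\<^sub>R axis j 1) = u"
    using basis_expansion[of u] by (simp add: scalar_mult_eq_scaleR)
  finally show ?thesis .
qed

text \<open>The material acceleration \<open>\<partial>\<^sub>t v + (v \<bullet> \<nabla>) v\<close>.\<close>

definition F :: "(real^'n) \<times> real \<Rightarrow> real^'n" where
  "F z = V' z (v (fst z) (snd z), 1)"

text \<open>The momentum equation solved for the pressure gradient. The right-hand side can be
  differentiated once more, which supplies second derivatives of \<open>p\<close>.\<close>

lemma pressure_derivative:
  assumes t: "t \<in> time_dom T"
  shows "((\<lambda>y. p y t) has_derivative (\<lambda>k. - (\<rho> x t * (F (x, t) \<bullet> k)))) (at x)"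
proof -
  have lin: "linear (V' (x, t))" using V'[of "(x, t)"] t by (auto intro: has_derivative_linear)
  have "time_deriv T v x t = V' (x, t) (0, 1)"
    unfolding time_deriv_def using time_slice_derivative[OF V' t] by simp
  moreover have "F (x, t) = V' (x, t) ((0, 1) + (v x t, 0))" by (simp add: F_def)
  ultimately have "F (x, t) = time_deriv T v x t + convective (v x t) (\<lambda>y. v y t) x"
    using convective_v[OF t] by (simp only: linear_add[OF lin] J_def)
  then have grad: "gradient (\<lambda>y. p y t) x = - (\<rho> x t *\<^sub>R F (x, t))"
    using momentum[OF t, of x] by (simp add: scaleR_add_right) 
  obtain q where q: "((\<lambda>y. p y t) has_derivative q) (at x)"
    using p[OF t] by (auto simp: differentiable_on_def differentiable_def)
  have "q k = - (\<rho> x t * (F (x, t) \<bullet> k))" for k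
  proof -
    have "q k = q (\<Sum>j\<in>UNIV. k $ j *\<^sub>R axis j 1)"
      using basis_expansion[of k] by (simp add: scalar_mult_eq_scaleR)
    also have "\<dots> = (\<Sum>j\<in>UNIV. k $ j * q (axis j 1))"
      using has_derivative_linear[OF q] by (simp add: linear_sum linear_cmul)
    also have "\<dots> = gradient (\<lambda>y. p y t) x \<bullet> k"
      using frechet_derivative_at[OF q] by (simp add: gradient_def partial_def inner_vec_def mult.commute)
    finally show ?thesis by (simp add: grad)
  qed
  then have "q = (\<lambda>k. - (\<rho> x t * (F (x, t) \<bullet> k)))" by blast
  then show ?thesis using q by simp
qed

lemma interior_at_within:
  fixes x :: "real^'n"
  assumes "0 < t" "t \<in> time_dom T"
  shows "at (x, t) within UNIV \<times> time_dom T = at (x, t)"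
  using interior_time_dom[OF assms] by (intro at_within_interior) (simp add: interior_Times)

text \<open>Scalar symmetry applied to each pairing of \<open>v\<close> with a fixed vector, on the
  open set of space-time points with interior time.\<close>

lemma V''_symmetric:
  assumes "0 < t" "t \<in> time_dom T"
  shows "V'' h (x, t) k = V'' k (x, t) h"
proof (rule vector_eq_ldot[THEN iffD1, rule_format])
  fix e :: "real^'n"
  define S where "S = (UNIV :: (real^'n) set) \<times> interior (time_dom T)"
  have S: "open S" "(x, t) \<in> S"
    using interior_time_dom[OF assms] by (auto simp: S_def open_Times)
  have sub: "S \<subseteq> UNIV \<times> time_dom T" using interior_subset by (auto simp: S_def)
  have at: "at z within UNIV \<times> time_dom T = at z" if "z \<in> S" for z
    using that by (intro at_within_interior) (auto simp: S_def interior_Times)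
  show "e \<bullet> V'' h (x, t) k = e \<bullet> V'' k (x, t) h"
  proof (rule symmetric_second_derivative[OF S, where f = "\<lambda>z. e \<bullet> (case z of (x, t) \<Rightarrow> v x t)" and f' = "\<lambda>z h. e \<bullet> V' z h"])
    fix z assume z: "z \<in> S"
    show "((\<lambda>z. e \<bullet> (case z of (x, t) \<Rightarrow> v x t)) has_derivative (\<lambda>h. e \<bullet> V' z h)) (at z)"
      using V'[of z] at[OF z] z sub by (intro has_derivative_inner_right) auto
  next
    have "((\<lambda>z. V' z b) has_derivative V'' b (x, t)) (at (x, t))" for b
      using V''[of "(x, t)" b] at[OF S(2)] assms by simp
    then show "((\<lambda>y. e \<bullet> V' y h) has_derivative (\<lambda>k. e \<bullet> V'' h (x, t) k)) (at (x, t))"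
      and "((\<lambda>y. e \<bullet> V' y k) has_derivative (\<lambda>h. e \<bullet> V'' k (x, t) h)) (at (x, t))"
      by (intro has_derivative_inner_right; assumption)+
  qed
qed

text \<open>Both the map \<open>V'\<close> and its argument \<open>(v, 1)\<close> vary. The product
  rule yields a sum of \<open>V'' b\<close> over basis vectors; symmetry moves \<open>b\<close> into
  the linear slot, where the sum reassembles to \<open>(v, 1)\<close>. For spatial \<open>h\<close>
  the last term is then the material derivative of \<open>J\<close> applied to
  \<open>h\<close>.\<close>

lemma F_derivative:
  assumes t: "0 < t" "t \<in> time_dom T"
  shows "(F has_derivative (\<lambda>h. V' (x, t) (V' (x, t) h, 0) + V'' h (x, t) (v x t, 1))) (at (x, t))"
proof -
  define S where "S = (UNIV :: (real^'n) set) \<times> interior (time_dom T)"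
  have S: "open S" "(x, t) \<in> S"
    using interior_time_dom[OF assms] by (auto simp: S_def open_Times)
  have lin: "linear (V' z)" if "z \<in> S" for z
    using that V'[of z] interior_subset by (auto simp: S_def intro: has_derivative_linear)
  have V'at: "((\<lambda>z. v (fst z) (snd z)) has_derivative V' (x, t)) (at (x, t))"
    using V'[of "(x, t)"] interior_at_within[OF t] t by (simp add: split_def)
  have V''at: "((\<lambda>z. V' z b) has_derivative V'' b (x, t)) (at (x, t))" for b
    using V''[of "(x, t)" b] interior_at_within[OF t] t by simp
  have "(F has_derivative (\<lambda>h. V' (x, t) (V' (x, t) h, 0) +
      (\<Sum>b\<in>Basis. ((v (fst (x, t)) (snd (x, t)), 1) \<bullet> b) *\<^sub>R V'' b (x, t) h))) (at (x, t))"
    unfolding F_def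
    by (rule has_derivative_apply_linear[OF S lin V''at has_derivative_Pair[OF V'at has_derivative_const]])
  moreover have "(\<Sum>b\<in>Basis. (w \<bullet> b) *\<^sub>R V'' b (x, t) h) = V'' h (x, t) w" for w h
  proof -
    have "(\<Sum>b\<in>Basis. (w \<bullet> b) *\<^sub>R V'' b (x, t) h) = (\<Sum>b\<in>Basis. (w \<bullet> b) *\<^sub>R V'' h (x, t) b)"
      by (simp only: V''_symmetric[OF t, of _ x h])
    also have "\<dots> = V'' h (x, t) (\<Sum>b\<in>Basis. (w \<bullet> b) *\<^sub>R b)"
      using has_derivative_linear[OF V''at] by (simp add: linear_sum linear_cmul)
    finally show ?thesis by (simp add: euclidean_representation)
  qed
  ultimately show ?thesis by simp
qed

text \<open>Differentiating \<open>\<rho> F\<close> produces \<open>\<rho>\<close> times the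
  derivative of \<open>F\<close> plus a product of \<open>F\<close> with the derivative of
  \<open>\<rho>\<close>. The total is symmetric as a second derivative of \<open>p\<close>, the
  product is symmetric because the gradients are parallel, and dividing by \<open>\<rho>\<close>
  leaves \<open>F\<close>.\<close>

lemma F_irrotational:
  assumes t: "0 < t" "t \<in> time_dom T" and nz: "\<rho> x t \<noteq> 0"
    and G: "(F has_derivative G) (at (x, t))"
  shows "G (h, 0) \<bullet> k = G (k, 0) \<bullet> h"
proof -
  define r where "r h = R' (x, t) (h, 0)" for h
  have \<rho>': "((\<lambda>y. \<rho> y t) has_derivative r) (at y)" if "y = x" for y
    using slice_derivative[OF R' t(2), of y] that by (simp add: r_def[abs_def])
  have \<rho>c: "continuous_on UNIV (\<lambda>y. \<rho> y t)"
    using has_derivative_continuous_on[OF slice_derivative[OF R' t(2)]] by simp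
  have "((\<lambda>y. (y, t)) has_derivative (\<lambda>h. (h, 0))) (at x)"
    by (auto intro!: derivative_eq_intros)
  then have F': "((\<lambda>y. F (y, t)) has_derivative (\<lambda>h. G (h, 0))) (at x)"
    by (rule has_derivative_compose) (rule G)
  have A: "((\<lambda>y. - (\<rho> y t * (F (y, t) \<bullet> k))) has_derivative
      (\<lambda>h. - (\<rho> x t * (G (h, 0) \<bullet> k) + r h * (F (x, t) \<bullet> k)))) (at x)" for k
    by (intro has_derivative_minus has_derivative_mult has_derivative_inner_left F' \<rho>' refl)
  have "- (\<rho> x t * (G (k, 0) \<bullet> h) + r k * (F (x, t) \<bullet> h))
      = - (\<rho> x t * (G (h, 0) \<bullet> k) + r h * (F (x, t) \<bullet> k))"
    by (rule symmetric_second_derivative[OF open_UNIV UNIV_I pressure_derivative[OF t(2)] A A])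
  moreover have "r h * - (\<rho> x t * (F (x, t) \<bullet> k)) = r k * - (\<rho> x t * (F (x, t) \<bullet> h))"
    by (rule parallel_derivatives[OF \<rho>'[OF refl] pressure_derivative[OF t(2)] \<rho>c P[OF t(2)]])
  then have "r h * (F (x, t) \<bullet> k) = r k * (F (x, t) \<bullet> h)" using nz by (simp add: algebra_simps)
  ultimately show ?thesis using nz by simp
qed

text \<open>By \<open>F_derivative\<close>, the material derivative of \<open>J h\<close> is the
  derivative of \<open>F\<close> minus \<open>J (J h)\<close>. Antisymmetrizing removes the
  contribution of \<open>F\<close>.\<close>

lemma vorticity_form_derivative:
  assumes t: "0 < t" "t \<in> time_dom T" and nz: "\<rho> (X a t) t \<noteq> 0"
  shows "((\<lambda>s. J (X a s) s h \<bullet> k - J (X a s) s k \<bullet> h) has_vector_derivative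
    J (X a t) t (J (X a t) t k) \<bullet> h - J (X a t) t (J (X a t) t h) \<bullet> k) (at t)"
proof -
  let ?z = "(X a t, t)"
  let ?w = "(v (X a t) t, 1)"
  have d: "((\<lambda>s. J (X a s) s h) has_vector_derivative V'' (h, 0) ?z ?w) (at t)" for h
    using path_derivative[OF V'' t(2), of a "(h, 0)"] at_within_interior[OF interior_time_dom[OF t]]
    by (simp add: J_def)
  have "((\<lambda>s. J (X a s) s h \<bullet> k - J (X a s) s k \<bullet> h) has_vector_derivative
      V'' (h, 0) ?z ?w \<bullet> k - V'' (k, 0) ?z ?w \<bullet> h) (at t)"
    by (intro has_vector_derivative_diff d
        bounded_linear.has_vector_derivative[OF bounded_linear_inner_left])
  moreover have "V'' (h, 0) ?z ?w \<bullet> k - V'' (k, 0) ?z ?w \<bullet> h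
      = J (X a t) t (J (X a t) t k) \<bullet> h - J (X a t) t (J (X a t) t h) \<bullet> k"
    using F_irrotational[OF t nz F_derivative[OF t], of h k]
    by (simp add: J_def inner_add_left)
  ultimately show ?thesis by simp
qed

text \<open>Expanding the divergence of \<open>\<rho> v\<close> separates the convective part, which
  joins the time derivative to form the material derivative, from \<open>\<rho>\<close> times the
  divergence of \<open>v\<close>.\<close>

lemma density_derivative:
  assumes t: "t \<in> time_dom T"
  shows "((\<lambda>s. \<rho> (X a s) s) has_vector_derivative
    - (\<rho> (X a t) t * (\<Sum>i\<in>UNIV. J (X a t) t (axis i 1) $ i))) (at t within time_dom T)"
proof -
  define x where "x = X a t"
  have lin: "linear (R' (x, t))" using R'[of "(x, t)"] t by (auto intro: has_derivative_linear)
  have \<rho>': "((\<lambda>y. \<rho> y t) has_derivative (\<lambda>h. R' (x, t) (h, 0))) (at x)"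
    using slice_derivative[OF R' t] by simp
  have part: "partial i (\<lambda>y. (\<rho> y t *\<^sub>R v y t) $ i) x
      = \<rho> x t * J x t (axis i 1) $ i + R' (x, t) (axis i 1, 0) * v x t $ i" for i
  proof -
    have "((\<lambda>y. \<rho> y t * v y t $ i) has_derivative
        (\<lambda>h. \<rho> x t * J x t h $ i + R' (x, t) (h, 0) * v x t $ i)) (at x)"
      by (intro has_derivative_mult \<rho>' bounded_linear.has_derivative[OF bounded_linear_vec_nth] v_derivative t)
    then show ?thesis by (simp add: partial_def frechet_derivative_at[symmetric])
  qed
  have "(\<Sum>i\<in>UNIV. R' (x, t) (axis i 1, 0) * v x t $ i) = R' (x, t) (v x t, 0)"
  proof -
    have "linear (\<lambda>h. R' (x, t) (h, 0))" using has_derivative_linear[OF \<rho>'] .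
    then have "R' (x, t) (\<Sum>i\<in>UNIV. v x t $ i *\<^sub>R axis i 1, 0) = (\<Sum>i\<in>UNIV. v x t $ i * R' (x, t) (axis i 1, 0))"
      by (simp add: linear_sum[of "\<lambda>h. R' (x, t) (h, 0)"] linear_cmul[of "\<lambda>h. R' (x, t) (h, 0)"])
    then show ?thesis
      using basis_expansion[of "v x t"] by (simp add: scalar_mult_eq_scaleR mult.commute)
  qed
  then have "divergence (\<lambda>y. \<rho> y t *\<^sub>R v y t) x
      = \<rho> x t * (\<Sum>i\<in>UNIV. J x t (axis i 1) $ i) + R' (x, t) (v x t, 0)"
    by (simp add: divergence_def part[simplified] sum.distrib sum_distrib_left)
  moreover have "time_deriv T \<rho> x t = R' (x, t) (0, 1)"
    unfolding time_deriv_def using time_slice_derivative[OF R' t] by simp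
  moreover have "R' (x, t) (v x t, 1) = R' (x, t) (v x t, 0) + R' (x, t) (0, 1)"
    using linear_add[OF lin, of "(v x t, 0)" "(0, 1)"] by simp
  ultimately have "R' (x, t) (v x t, 1) = - (\<rho> x t * (\<Sum>i\<in>UNIV. J x t (axis i 1) $ i))"
    using mass[OF t, of x] by simp
  then show ?thesis using path_derivative[OF R' t, of a] by (simp add: x_def)
qed

text \<open>Along a particle the density solves a scalar linear equation whose coefficient, the
  divergence, is bounded on the compact time interval.\<close>

lemma density_nonzero:
  assumes t0: "t0 \<in> time_dom T" and "\<rho> a 0 \<noteq> 0"
  shows "\<rho> (X a t0) t0 \<noteq> 0"
proof -
  define c where "c t = (\<Sum>i\<in>UNIV. J (X a t) t (axis i 1) $ i)" for t
  have "continuous_on {0..t0} c"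
    unfolding c_def
    by (intro continuous_intros continuous_on_subset[OF J_path_continuous time_dom_Icc[OF t0]])
  then obtain C where C: "\<And>t. t \<in> {0..t0} \<Longrightarrow> norm (c t) \<le> C"
    using continuous_on_interval_bound by metis
  show ?thesis
  proof (rule gronwall_nonvanishing[where u = "\<lambda>t. \<rho> (X a t) t" and u' = "\<lambda>t. - (\<rho> (X a t) t * c t)" and C = C])
    show "continuous_on {0..t0} (\<lambda>t. \<rho> (X a t) t)"
      by (rule continuous_on_subset[OF _ time_dom_Icc[OF t0]])
        (auto simp: continuous_on_eq_continuous_within intro: has_vector_derivative_continuous density_derivative)
  next
    fix t assume t: "0 < t" "t < t0"
    then have "t \<in> time_dom T" using time_dom_Icc[OF t0] by auto
    then show "((\<lambda>t. \<rho> (X a t) t) has_vector_derivative - (\<rho> (X a t) t * c t)) (at t)"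
      using density_derivative[of t a] at_within_interior[OF interior_time_dom] t by (simp add: c_def)
    show "norm (- (\<rho> (X a t) t * c t)) \<le> C * norm (\<rho> (X a t) t)"
      using C[of t] t by (simp add: abs_mult mult.commute mult_right_mono)
  qed (use t0 assms X0 in \<open>auto simp: time_dom_def\<close>)
qed

lemma vorticity_density_derivative:
  assumes t: "0 < t" "t \<in> time_dom T" and nz: "\<rho> (X a t) t \<noteq> 0"
  shows "((\<lambda>s. (J (X a s) s h \<bullet> k - J (X a s) s k \<bullet> h) / \<rho> (X a s) s) has_real_derivative
    (J (X a t) t (J (X a t) t k) \<bullet> h - J (X a t) t (J (X a t) t h) \<bullet> k
      + (\<Sum>i\<in>UNIV. J (X a t) t (axis i 1) $ i) * (J (X a t) t h \<bullet> k - J (X a t) t k \<bullet> h))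
    / \<rho> (X a t) t) (at t)"
proof -
  have r: "((\<lambda>s. \<rho> (X a s) s) has_real_derivative
      - (\<rho> (X a t) t * (\<Sum>i\<in>UNIV. J (X a t) t (axis i 1) $ i))) (at t)"
    using density_derivative[OF t(2), of a] at_within_interior[OF interior_time_dom[OF t]]
    by (simp add: has_real_derivative_iff_has_vector_derivative)
  \<comment> \<open>Dividing by a density that decays at the rate \<open>c\<close> of the divergence
    adds \<open>c\<close> times the form; this is the term that later cancels the trace.\<close>
  have quot: "(q' * r - q * - (r * c)) / (r * r) = (q' + c * q) / r" if "r \<noteq> 0" for q' q r c :: real
    using that by (simp add: divide_simps) (simp add: algebra_simps)
  show ?thesis
    using DERIV_divide[OF vorticity_form_derivative[OF t nz, of h k,
        folded has_real_derivative_iff_has_vector_derivative] r nz]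
    by (simp only: quot[OF nz])
qed

lemma vorticity_density_continuous:
  assumes t0: "t0 \<in> time_dom T" and "\<rho> a 0 \<noteq> 0"
  shows "continuous_on {0..t0} (\<lambda>s. (J (X a s) s h \<bullet> k - J (X a s) s k \<bullet> h) / \<rho> (X a s) s)"
proof -
  have "continuous_on (time_dom T) (\<lambda>s. \<rho> (X a s) s)"
    by (auto simp: continuous_on_eq_continuous_within intro: has_vector_derivative_continuous density_derivative)
  then have "continuous_on (time_dom T) (\<lambda>s. (J (X a s) s h \<bullet> k - J (X a s) s k \<bullet> h) / \<rho> (X a s) s)"
    by (intro continuous_intros J_path_continuous) (auto simp: density_nonzero assms)
  then show ?thesis by (rule continuous_on_subset[OF _ time_dom_Icc[OF t0]])
qed

end

section \<open>Coordinates in dimensions two and three, and the derivatives attached to a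
  solution\<close>

lemma vector_3_expansion:
  "(vector [a, b, c] :: real^3) = a *\<^sub>R axis 1 1 + b *\<^sub>R axis 2 1 + c *\<^sub>R axis 3 1"
  by (simp add: vec_eq_iff forall_3 axis_def)

lemma linear_expansion_3:
  fixes L :: "real^3 \<Rightarrow> 'a::real_vector"
  assumes "linear L"
  shows "L x = x $ 1 *\<^sub>R L (axis 1 1) + x $ 2 *\<^sub>R L (axis 2 1) + x $ 3 *\<^sub>R L (axis 3 1)"
proof -
  have "x = x $ 1 *\<^sub>R axis 1 1 + x $ 2 *\<^sub>R axis 2 1 + x $ 3 *\<^sub>R axis 3 1"
    by (simp add: vec_eq_iff forall_3 axis_def)
  then have "L x = L (x $ 1 *\<^sub>R axis 1 1 + x $ 2 *\<^sub>R axis 2 1 + x $ 3 *\<^sub>R axis 3 1)" by (rule arg_cong)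
  then show ?thesis using assms by (simp add: linear_add linear_cmul)
qed

lemma linear_expansion_2:
  fixes L :: "real^2 \<Rightarrow> 'a::real_vector"
  assumes "linear L"
  shows "L x = x $ 1 *\<^sub>R L (axis 1 1) + x $ 2 *\<^sub>R L (axis 2 1)"
proof -
  have "x = x $ 1 *\<^sub>R axis 1 1 + x $ 2 *\<^sub>R axis 2 1"
    by (simp add: vec_eq_iff forall_2 axis_def)
  then have "L x = L (x $ 1 *\<^sub>R axis 1 1 + x $ 2 *\<^sub>R axis 2 1)" by (rule arg_cong)
  then show ?thesis using assms by (simp add: linear_add linear_cmul)
qed

lemma has_vector_derivative_vector_3:
  assumes "(f has_vector_derivative f') F" "(g has_vector_derivative g') F" "(h has_vector_derivative h') F"
  shows "((\<lambda>s. vector [f s, g s, h s] :: real^3) has_vector_derivative vector [f', g', h']) F"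
  unfolding vector_3_expansion
  by (intro has_vector_derivative_add assms
      bounded_linear.has_vector_derivative[OF bounded_linear_scaleR_left])

lemma lagrangian_flow_exists:
  assumes "0 < T" "isentropic_euler_solution T v \<rho> p v\<^sub>0 \<rho>\<^sub>0" "particle_trajectory_map T v X"
  obtains P V' V'' R' where "lagrangian_flow T v \<rho> p P X V' V'' R'"
proof -
  note E = assms(2)[unfolded isentropic_euler_solution_def]
  from E obtain P where P: "\<forall>x. \<forall>t\<in>time_dom T. p x t = P (\<rho> x t)" by blast
  from E have sv: "smooth_on (UNIV \<times> time_dom T) (\<lambda>(x, t). v x t)"
    and sr: "smooth_on (UNIV \<times> time_dom T) (\<lambda>(x, t). \<rho> x t)" by blast+
  obtain V' V'' where V: "\<And>z. z \<in> UNIV \<times> time_dom T \<Longrightarrow>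
      ((\<lambda>(x, t). v x t) has_derivative V' z) (at z within UNIV \<times> time_dom T)"
    "\<And>h z. z \<in> UNIV \<times> time_dom T \<Longrightarrow>
      ((\<lambda>z. V' z h) has_derivative V'' h z) (at z within UNIV \<times> time_dom T)"
    by (rule smooth_on_twice[OF sv]) blast
  obtain R' R'' where R: "\<And>z. z \<in> UNIV \<times> time_dom T \<Longrightarrow>
      ((\<lambda>(x, t). \<rho> x t) has_derivative R' z) (at z within UNIV \<times> time_dom T)"
    "\<And>h z. z \<in> UNIV \<times> time_dom T \<Longrightarrow>
      ((\<lambda>z. R' z h) has_derivative R'' h z) (at z within UNIV \<times> time_dom T)"
    by (rule smooth_on_twice[OF sr]) blast
  have "lagrangian_flow T v \<rho> p P X V' V'' R'"
    by unfold_locales (use assms(1,3) E P V R in \<open>auto simp: particle_trajectory_map_def\<close>)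
  then show ?thesis by (rule that)
qed

text \<open>The derivative of the inverse is a left inverse of \<open>A\<close>. Injectivity ensures
  that the flow neither creates nor destroys zeros of the vorticity.\<close>

lemma diffeomorphism_derivative:
  assumes "diffeomorphism f"
  obtains A where "(f has_derivative A) (at x)" "\<And>h. A h = 0 \<Longrightarrow> h = 0"
proof -
  have "bij f" "C_k_on (Suc 0) UNIV f" "C_k_on (Suc 0) UNIV (inv f)"
    using assms unfolding diffeomorphism_def smooth_on_def by blast+
  then obtain A B where A: "(f has_derivative A) (at x)" and B: "(inv f has_derivative B) (at (f x))"
    unfolding C_k_on.simps(2) by blast
  have "((\<lambda>y. inv f (f y)) has_derivative (\<lambda>h. B (A h))) (at x)"
    by (rule has_derivative_compose[OF A B])
  then have "((\<lambda>y. y) has_derivative (\<lambda>h. B (A h))) (at x)"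
    using \<open>bij f\<close> by (simp add: bij_is_inj)
  then have "(\<lambda>h. B (A h)) = (\<lambda>h. h)"
    using has_derivative_unique has_derivative_ident by blast
  then have "B (A h) = h" for h by meson
  moreover have "B 0 = 0" using has_derivative_linear[OF B] by (rule linear_0)
  ultimately show ?thesis using that[OF A] by metis
qed

section \<open>Vortex lines\<close>

text \<open>The hypothesis \<open>zero\<close> matters where \<open>\<omega>\<^sub>0\<close> vanishes: both ratios are then \<open>0/0 = 0\<close>.\<close>

lemma transported_vortex_line:
  assumes I: "is_interval I" "interior I \<noteq> {}"
    and \<gamma>\<^sub>0: "\<And>s. s \<in> I \<Longrightarrow> f s \<noteq> 0 \<and> (\<gamma>\<^sub>0 has_vector_derivative f s *\<^sub>R \<omega>\<^sub>0 (\<gamma>\<^sub>0 s)) (at s within I)"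
    and \<gamma>: "\<And>s. s \<in> I \<Longrightarrow>
      (\<gamma> has_vector_derivative (f s * \<rho>\<^sub>0 (\<gamma>\<^sub>0 s) / \<rho> (\<gamma> s)) *\<^sub>R \<omega> (\<gamma> s)) (at s within I)"
    and nz: "\<And>s. s \<in> I \<Longrightarrow> \<rho>\<^sub>0 (\<gamma>\<^sub>0 s) \<noteq> 0" "\<And>s. s \<in> I \<Longrightarrow> \<rho> (\<gamma> s) \<noteq> 0"
    and zero: "\<And>s. s \<in> I \<Longrightarrow> \<omega> (\<gamma> s) = 0 \<longleftrightarrow> \<omega>\<^sub>0 (\<gamma>\<^sub>0 s) = 0"
  shows "integral_curve \<omega> \<gamma> I \<and> (\<forall>s\<in>I. vortex_ratio \<omega> \<rho> \<gamma> I s = vortex_ratio \<omega>\<^sub>0 \<rho>\<^sub>0 \<gamma>\<^sub>0 I s)"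
proof (intro conjI ballI)
  show "integral_curve \<omega> \<gamma> I"
    unfolding integral_curve_def using I \<gamma> \<gamma>\<^sub>0 nz
    by (intro conjI exI[of _ "\<lambda>s. f s * \<rho>\<^sub>0 (\<gamma>\<^sub>0 s) / \<rho> (\<gamma> s)"]) auto
next
  fix s assume s: "s \<in> I"
  note bot = at_within_interval_neq_bot[OF I s]
  have "vector_derivative \<gamma> (at s within I) = (f s * \<rho>\<^sub>0 (\<gamma>\<^sub>0 s) / \<rho> (\<gamma> s)) *\<^sub>R \<omega> (\<gamma> s)"
    and "vector_derivative \<gamma>\<^sub>0 (at s within I) = f s *\<^sub>R \<omega>\<^sub>0 (\<gamma>\<^sub>0 s)"
    using vector_derivative_within[OF bot] \<gamma> \<gamma>\<^sub>0 s by blast+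
  then show "vortex_ratio \<omega> \<rho> \<gamma> I s = vortex_ratio \<omega>\<^sub>0 \<rho>\<^sub>0 \<gamma>\<^sub>0 I s"
    using nz[OF s] zero[OF s] \<gamma>\<^sub>0[OF s]
    by (cases "\<omega>\<^sub>0 (\<gamma>\<^sub>0 s) = 0") (auto simp: vortex_ratio_def abs_mult)
qed

lemma spatial_vorticity_transport:
  fixes v :: "real^3 \<Rightarrow> real \<Rightarrow> real^3"
  assumes flow: "lagrangian_flow T v \<rho> p P X V' V'' R'" and nz: "\<rho> a 0 \<noteq> 0"
    and t0: "t0 \<in> time_dom T" and A: "((\<lambda>b. X b t0) has_derivative A) (at a)"
  shows "A ((1 / \<rho> a 0) *\<^sub>R curl (\<lambda>x. v x 0) a)
    = (1 / \<rho> (X a t0) t0) *\<^sub>R curl (\<lambda>x. v x t0) (X a t0)"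
proof -
  interpret lagrangian_flow T v \<rho> p P X V' V'' R' by (rule flow)
  define q where "q i j s = (J (X a s) s (axis i 1) \<bullet> axis j 1 - J (X a s) s (axis j 1) \<bullet> axis i 1) / \<rho> (X a s) s"
    for i j :: 3 and s
  define W where "W s = (vector [q 2 3 s, q 3 1 s, q 1 2 s] :: real^3)" for s
  have W: "W s = (1 / \<rho> (X a s) s) *\<^sub>R curl (\<lambda>x. v x s) (X a s)" if "s \<in> time_dom T" for s
    by (simp add: vec_eq_iff forall_3 W_def q_def curl_def partial_v[OF that] inner_axis)
  have qc: "continuous_on {0..t0} (q i j)" for i j
    unfolding q_def[abs_def] by (rule vorticity_density_continuous[OF t0 nz])
  have "A (W 0) = W t0"
  proof (rule flow_derivative_along_path[where v = v and D = J and X = X and a = a, OF _ v_derivative J_continuous[OF t0] X_derivative_Icc[OF t0] X0 _ _ A])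
    show "continuous_on {0..t0} W"
      unfolding W_def vector_3_expansion by (intro continuous_intros qc)
  next
    fix t assume "0 < t" "t < t0"
    then have t: "0 < t" "t \<in> time_dom T" using time_dom_Icc[OF t0] by auto
    define M where "M i j = J (X a t) t (axis j 1) $ i" for i j :: 3
    define r where "r = \<rho> (X a t) t"
    have r: "r \<noteq> 0" unfolding r_def by (rule density_nonzero[OF t(2) nz])
    have JJ: "J (X a t) t w $ i = w $ 1 * M i 1 + w $ 2 * M i 2 + w $ 3 * M i 3" for w i
      by (subst linear_expansion_3[OF linear_J[OF t(2)], of "X a t" w]) (simp add: M_def)
    have Mfold: "J (X a t) t (axis j 1) $ i = M i j" for i j by (simp add: M_def)
    have q': "(q i j has_vector_derivative
        ((M i 1 * M 1 j + M i 2 * M 2 j + M i 3 * M 3 j) - (M j 1 * M 1 i + M j 2 * M 2 i + M j 3 * M 3 i)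
          + (M 1 1 + M 2 2 + M 3 3) * (M j i - M i j)) / r) (at t)" for i j
      using vorticity_density_derivative[OF t density_nonzero[OF t(2) nz], of "axis i 1" "axis j 1"]
      unfolding q_def[abs_def] has_real_derivative_iff_has_vector_derivative
      by (simp add: inner_axis JJ[of "J (X a t) t w" for w] Mfold sum_3 r_def algebra_simps)
    \<comment> \<open>With w the axial vector of the form, Mh x k + h x Mk = (tr M - M^T)(h x k)
      gives w' = M w - (tr M) w. The division by the density adds the opposite trace term, so only
      \<open>J\<close> applied to \<open>W t\<close> remains.\<close>
    have "(W has_vector_derivative vector
       [((M 2 1 * M 1 3 + M 2 2 * M 2 3 + M 2 3 * M 3 3) - (M 3 1 * M 1 2 + M 3 2 * M 2 2 + M 3 3 * M 3 2)
          + (M 1 1 + M 2 2 + M 3 3) * (M 3 2 - M 2 3)) / r,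
        ((M 3 1 * M 1 1 + M 3 2 * M 2 1 + M 3 3 * M 3 1) - (M 1 1 * M 1 3 + M 1 2 * M 2 3 + M 1 3 * M 3 3)
          + (M 1 1 + M 2 2 + M 3 3) * (M 1 3 - M 3 1)) / r,
        ((M 1 1 * M 1 2 + M 1 2 * M 2 2 + M 1 3 * M 3 2) - (M 2 1 * M 1 1 + M 2 2 * M 2 1 + M 2 3 * M 3 1)
          + (M 1 1 + M 2 2 + M 3 3) * (M 2 1 - M 1 2)) / r]) (at t)"
      unfolding W_def[abs_def] by (intro has_vector_derivative_vector_3 q')
    moreover have Wt: "W t $ 1 = (M 3 2 - M 2 3) / r" "W t $ 2 = (M 1 3 - M 3 1) / r" "W t $ 3 = (M 2 1 - M 1 2) / r"
      by (simp_all add: W_def q_def inner_axis Mfold r_def)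
    ultimately show "(W has_vector_derivative J (X a t) t (W t)) (at t)"
      by (elim has_vector_derivative_eq_rhs)
        (simp add: vec_eq_iff forall_3 JJ Wt r add_divide_distrib[symmetric] algebra_simps)
  qed (use t0 time_dom_Icc[OF t0] in \<open>auto simp: time_dom_def\<close>)
  then show ?thesis using W[OF t0] W[OF zero_in_time_dom[OF T]] X0 by simp
qed

text \<open>In the plane det(Mh,k) + det(h,Mk) = (tr M) det(h,k), so vorticity and density decay at
  the same rate, the divergence.\<close>

lemma planar_vorticity_transport:
  fixes v :: "real^2 \<Rightarrow> real \<Rightarrow> real^2"
  assumes flow: "lagrangian_flow T v \<rho> p P X V' V'' R'" and nz: "\<rho> a 0 \<noteq> 0"
    and t0: "t0 \<in> time_dom T"
  defines "\<Omega> \<equiv> \<lambda>x t. partial 1 (\<lambda>y. v y t $ 2) x - partial 2 (\<lambda>y. v y t $ 1) x"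
  shows "\<Omega> (X a t0) t0 / \<rho> (X a t0) t0 = \<Omega> a 0 / \<rho> a 0"
proof -
  interpret lagrangian_flow T v \<rho> p P X V' V'' R' by (rule flow)
  define q where "q s = (J (X a s) s (axis 1 1) \<bullet> axis 2 1 - J (X a s) s (axis 2 1) \<bullet> axis 1 1) / \<rho> (X a s) s" for s
  have q: "q s = \<Omega> (X a s) s / \<rho> (X a s) s" if "s \<in> time_dom T" for s
    by (simp add: q_def \<Omega>_def partial_v[OF that] inner_axis)
  have qc: "continuous_on {0..t0} q"
    unfolding q_def[abs_def] by (rule vorticity_density_continuous[OF t0 nz])
  have q': "(q has_real_derivative 0) (at t)" if "0 < t" "t < t0" for t
  proof -
    have t: "0 < t" "t \<in> time_dom T" using that time_dom_Icc[OF t0] by auto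
    define M where "M i j = J (X a t) t (axis j 1) $ i" for i j :: 2
    have JJ: "J (X a t) t w $ i = w $ 1 * M i 1 + w $ 2 * M i 2" for w i
      by (subst linear_expansion_2[OF linear_J[OF t(2)], of "X a t" w]) (simp add: M_def)
    have Mfold: "J (X a t) t (axis j 1) $ i = M i j" for i j by (simp add: M_def)
    show ?thesis
      using vorticity_density_derivative[OF t density_nonzero[OF t(2) nz], of "axis 1 1" "axis 2 1"]
      unfolding q_def[abs_def]
      by (simp add: inner_axis JJ[of "J (X a t) t w" for w] Mfold sum_2 algebra_simps)
  qed
  have "0 \<le> t0" using t0 by (simp add: time_dom_def)
  then have "q t0 = q 0"
    using DERIV_isconst_end[OF _ qc q'] by (cases "t0 = 0") auto
  then show ?thesis using q[OF t0] q[OF zero_in_time_dom[OF T]] X0 by simp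
qed

section \<open>Invariance of the ratio in space and in the plane\<close>

lemma spatial_invariance:
  fixes v :: "real^3 \<Rightarrow> real \<Rightarrow> real^3"
  assumes T: "0 < T" and euler: "isentropic_euler_solution T v \<rho> p v\<^sub>0 \<rho>\<^sub>0"
    and traj: "particle_trajectory_map T v X"
    and line: "integral_curve (curl v\<^sub>0) \<gamma>\<^sub>0 I" and nz: "\<forall>s\<in>I. \<rho>\<^sub>0 (\<gamma>\<^sub>0 s) \<noteq> 0"
    and t: "t \<in> time_dom T"
  shows "integral_curve (curl (\<lambda>x. v x t)) (\<lambda>s. X (\<gamma>\<^sub>0 s) t) I \<and>
    (\<forall>s\<in>I. vortex_ratio (curl (\<lambda>x. v x t)) (\<lambda>x. \<rho> x t) (\<lambda>s. X (\<gamma>\<^sub>0 s) t) I s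
      = vortex_ratio (curl v\<^sub>0) \<rho>\<^sub>0 \<gamma>\<^sub>0 I s)"
proof -
  obtain P V' V'' R' where flow: "lagrangian_flow T v \<rho> p P X V' V'' R'"
    using lagrangian_flow_exists[OF T euler traj] .
  interpret lagrangian_flow T v \<rho> p P X V' V'' R' by (rule flow)
  have init: "(\<lambda>x. v x 0) = v\<^sub>0" "\<And>x. \<rho> x 0 = \<rho>\<^sub>0 x"
    using euler by (auto simp: isentropic_euler_solution_def)
  obtain f where I: "is_interval I" "interior I \<noteq> {}" and
    f: "\<And>s. s \<in> I \<Longrightarrow> f s \<noteq> 0 \<and> (\<gamma>\<^sub>0 has_vector_derivative f s *\<^sub>R curl v\<^sub>0 (\<gamma>\<^sub>0 s)) (at s within I)"
    using line unfolding integral_curve_def by blast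
  have \<rho>nz: "\<rho> (X (\<gamma>\<^sub>0 s) t) t \<noteq> 0" if "s \<in> I" for s
    using density_nonzero[OF t] nz that init(2) by simp
  have diffeo: "diffeomorphism (\<lambda>a. X a t)" using traj t by (simp add: particle_trajectory_map_def)
  have key: "\<exists>A. ((\<lambda>b. X b t) has_derivative A) (at (\<gamma>\<^sub>0 s)) \<and> (\<forall>h. A h = 0 \<longrightarrow> h = 0) \<and>
      A (curl v\<^sub>0 (\<gamma>\<^sub>0 s)) = (\<rho>\<^sub>0 (\<gamma>\<^sub>0 s) / \<rho> (X (\<gamma>\<^sub>0 s) t) t) *\<^sub>R curl (\<lambda>x. v x t) (X (\<gamma>\<^sub>0 s) t)"
    if s: "s \<in> I" for s
  proof -
    obtain A where A: "((\<lambda>b. X b t) has_derivative A) (at (\<gamma>\<^sub>0 s))" "\<And>h. A h = 0 \<Longrightarrow> h = 0"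
      using diffeomorphism_derivative[OF diffeo, of "\<gamma>\<^sub>0 s"] by blast
    have "(1 / \<rho>\<^sub>0 (\<gamma>\<^sub>0 s)) *\<^sub>R A (curl v\<^sub>0 (\<gamma>\<^sub>0 s))
        = (1 / \<rho> (X (\<gamma>\<^sub>0 s) t) t) *\<^sub>R curl (\<lambda>x. v x t) (X (\<gamma>\<^sub>0 s) t)"
      using spatial_vorticity_transport[OF flow _ t A(1)] nz s init
      by (simp add: linear_cmul[OF has_derivative_linear[OF A(1)]])
    from arg_cong[OF this, of "\<lambda>u. \<rho>\<^sub>0 (\<gamma>\<^sub>0 s) *\<^sub>R u"]
    have "A (curl v\<^sub>0 (\<gamma>\<^sub>0 s)) = (\<rho>\<^sub>0 (\<gamma>\<^sub>0 s) / \<rho> (X (\<gamma>\<^sub>0 s) t) t) *\<^sub>R curl (\<lambda>x. v x t) (X (\<gamma>\<^sub>0 s) t)"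
      using nz s by simp
    then show ?thesis using A by blast
  qed
  show ?thesis
  proof (rule transported_vortex_line[OF I f])
    fix s assume s: "s \<in> I"
    obtain A where A: "((\<lambda>b. X b t) has_derivative A) (at (\<gamma>\<^sub>0 s))" "\<And>h. A h = 0 \<Longrightarrow> h = 0"
      "A (curl v\<^sub>0 (\<gamma>\<^sub>0 s)) = (\<rho>\<^sub>0 (\<gamma>\<^sub>0 s) / \<rho> (X (\<gamma>\<^sub>0 s) t) t) *\<^sub>R curl (\<lambda>x. v x t) (X (\<gamma>\<^sub>0 s) t)"
      using key[OF s] by blast
    have lin: "linear A" using A(1) by (rule has_derivative_linear)
    have "((\<lambda>s. X (\<gamma>\<^sub>0 s) t) has_derivative (\<lambda>y. A (y *\<^sub>R f s *\<^sub>R curl v\<^sub>0 (\<gamma>\<^sub>0 s)))) (at s within I)"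
      by (rule has_derivative_compose[OF conjunct2[OF f[OF s], unfolded has_vector_derivative_def] A(1)])
    then show "((\<lambda>s. X (\<gamma>\<^sub>0 s) t) has_vector_derivative
        (f s * \<rho>\<^sub>0 (\<gamma>\<^sub>0 s) / \<rho> (X (\<gamma>\<^sub>0 s) t) t) *\<^sub>R curl (\<lambda>x. v x t) (X (\<gamma>\<^sub>0 s) t)) (at s within I)"
      by (simp add: has_vector_derivative_def linear_cmul[OF lin] A(3) mult.assoc)
    \<comment> \<open>The vorticities are related by the injective map \<open>A\<close> and a
      nonzero factor, so they vanish together.\<close>
    show "curl (\<lambda>x. v x t) (X (\<gamma>\<^sub>0 s) t) = 0 \<longleftrightarrow> curl v\<^sub>0 (\<gamma>\<^sub>0 s) = 0"
      using A(2)[of "curl v\<^sub>0 (\<gamma>\<^sub>0 s)"] A(3) linear_0[OF lin] nz s \<rho>nz[OF s] by auto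
  qed (use nz \<rho>nz in auto)
qed

text \<open>The first two components of a vortex line have zero derivative, so the line stays over
  one point \<open>a\<close> of the plane and is carried rigidly to the vertical line over
  \<open>X a t\<close>. Vorticity and density are constant on each line.\<close>

lemma planar_invariance:
  fixes v :: "real^2 \<Rightarrow> real \<Rightarrow> real^2"
  assumes T: "0 < T" and euler: "isentropic_euler_solution T v \<rho> p v\<^sub>0 \<rho>\<^sub>0"
    and traj: "particle_trajectory_map T v X"
    and line: "integral_curve (planar_vorticity v\<^sub>0) \<gamma>\<^sub>0 I"
    and nz: "\<forall>s\<in>I. planar_density \<rho>\<^sub>0 (\<gamma>\<^sub>0 s) \<noteq> 0"
    and t: "t \<in> time_dom T"
  shows "integral_curve (planar_vorticity (\<lambda>x. v x t)) (\<lambda>s. planar_map (\<lambda>a. X a t) (\<gamma>\<^sub>0 s)) I \<and>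
    (\<forall>s\<in>I. vortex_ratio (planar_vorticity (\<lambda>x. v x t)) (planar_density (\<lambda>x. \<rho> x t))
        (\<lambda>s. planar_map (\<lambda>a. X a t) (\<gamma>\<^sub>0 s)) I s
      = vortex_ratio (planar_vorticity v\<^sub>0) (planar_density \<rho>\<^sub>0) \<gamma>\<^sub>0 I s)"
proof -
  obtain P V' V'' R' where flow: "lagrangian_flow T v \<rho> p P X V' V'' R'"
    using lagrangian_flow_exists[OF T euler traj] .
  interpret lagrangian_flow T v \<rho> p P X V' V'' R' by (rule flow)
  have init: "\<And>x. v x 0 = v\<^sub>0 x" "\<And>x. \<rho> x 0 = \<rho>\<^sub>0 x"
    using euler by (auto simp: isentropic_euler_solution_def)
  obtain f where I: "is_interval I" "interior I \<noteq> {}" and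
    f: "\<And>s. s \<in> I \<Longrightarrow> f s \<noteq> 0 \<and> (\<gamma>\<^sub>0 has_vector_derivative f s *\<^sub>R planar_vorticity v\<^sub>0 (\<gamma>\<^sub>0 s)) (at s within I)"
    using line unfolding integral_curve_def by blast
  have comp: "((\<lambda>s. \<gamma>\<^sub>0 s $ i) has_vector_derivative f s * planar_vorticity v\<^sub>0 (\<gamma>\<^sub>0 s) $ i) (at s within I)"
    if "s \<in> I" for s i
    using bounded_linear.has_vector_derivative[OF bounded_linear_vec_nth[of i] conjunct2[OF f[OF that]]] by simp
  have "convex I" using I(1) by (simp add: is_interval_convex)
  obtain c1 where c1: "\<And>s. s \<in> I \<Longrightarrow> \<gamma>\<^sub>0 s $ 1 = c1"
    by (rule has_vector_derivative_zero_constant[OF \<open>convex I\<close>, of "\<lambda>s. \<gamma>\<^sub>0 s $ 1"])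
      (use comp[of _ 1] in \<open>auto simp: planar_vorticity_def\<close>)
  obtain c2 where c2: "\<And>s. s \<in> I \<Longrightarrow> \<gamma>\<^sub>0 s $ 2 = c2"
    by (rule has_vector_derivative_zero_constant[OF \<open>convex I\<close>, of "\<lambda>s. \<gamma>\<^sub>0 s $ 2"])
      (use comp[of _ 2] in \<open>auto simp: planar_vorticity_def\<close>)
  define a where "a = (vector [c1, c2] :: real^2)"
  have hor: "horizontal (\<gamma>\<^sub>0 s) = a" if "s \<in> I" for s
    using c1 c2 that by (simp add: horizontal_def a_def)
  have hor': "horizontal (planar_map (\<lambda>a. X a t) (\<gamma>\<^sub>0 s)) = X a t" if "s \<in> I" for s
    unfolding planar_map_def hor[OF that] by (simp add: horizontal_def vec_eq_iff forall_2)
  \<comment> \<open>The interval is nonempty since it has interior; any one of its points shows that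
    the density at \<open>a\<close> is nonzero.\<close>
  obtain s0 where "s0 \<in> I" using I(2) interior_subset by blast
  then have a0: "\<rho> a 0 \<noteq> 0" using nz hor init(2) by (auto simp: planar_density_def)
  have at: "\<rho> (X a t) t \<noteq> 0" by (rule density_nonzero[OF t a0])
  define \<Omega> where "\<Omega> x t = partial 1 (\<lambda>y. v y t $ 2) x - partial 2 (\<lambda>y. v y t $ 1) x" for x t
  have pv0: "planar_vorticity v\<^sub>0 (\<gamma>\<^sub>0 s) = vector [0, 0, \<Omega> a 0]" if "s \<in> I" for s
    using hor[OF that] by (simp add: planar_vorticity_def \<Omega>_def init)
  have pvt: "planar_vorticity (\<lambda>x. v x t) (planar_map (\<lambda>a. X a t) (\<gamma>\<^sub>0 s)) = vector [0, 0, \<Omega> (X a t) t]"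
    if "s \<in> I" for s
    using hor'[OF that] by (simp add: planar_vorticity_def \<Omega>_def)
  have \<Omega>: "\<Omega> (X a t) t / \<rho> (X a t) t = \<Omega> a 0 / \<rho> a 0"
    unfolding \<Omega>_def by (rule planar_vorticity_transport[OF flow a0 t])
  have pd0: "planar_density \<rho>\<^sub>0 (\<gamma>\<^sub>0 s) = \<rho> a 0" if "s \<in> I" for s
    using hor[OF that] by (simp add: planar_density_def init)
  have pdt: "planar_density (\<lambda>x. \<rho> x t) (planar_map (\<lambda>a. X a t) (\<gamma>\<^sub>0 s)) = \<rho> (X a t) t" if "s \<in> I" for s
    using hor'[OF that] by (simp add: planar_density_def)
  show ?thesis
  proof (rule transported_vortex_line[OF I f])
    fix s assume s: "s \<in> I"
    have "((\<lambda>s. vector [X a t $ 1, X a t $ 2, \<gamma>\<^sub>0 s $ 3] :: real^3) has_vector_derivative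
        vector [0, 0, f s * \<Omega> a 0]) (at s within I)"
      using comp[OF s, of 3] pv0[OF s]
      by (intro has_vector_derivative_vector_3 has_vector_derivative_const) simp
    then have "((\<lambda>s. planar_map (\<lambda>a. X a t) (\<gamma>\<^sub>0 s)) has_vector_derivative
        vector [0, 0, f s * \<Omega> a 0]) (at s within I)"
      by (rule has_vector_derivative_transform[OF s, rotated]) (simp add: planar_map_def hor)
    \<comment> \<open>The third velocity component of the curve is unchanged by the flow; constancy
      of the quotient rewrites it as the factor required by \<open>transported_vortex_line\<close>
      times the new vorticity.\<close>
    moreover have "f s * \<Omega> a 0 = (f s * \<rho> a 0 / \<rho> (X a t) t) * \<Omega> (X a t) t"
      using \<Omega> a0 at by (simp add: field_simps)
    ultimately show "((\<lambda>s. planar_map (\<lambda>a. X a t) (\<gamma>\<^sub>0 s)) has_vector_derivative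
        (f s * planar_density \<rho>\<^sub>0 (\<gamma>\<^sub>0 s) / planar_density (\<lambda>x. \<rho> x t) (planar_map (\<lambda>a. X a t) (\<gamma>\<^sub>0 s))) *\<^sub>R
          planar_vorticity (\<lambda>x. v x t) (planar_map (\<lambda>a. X a t) (\<gamma>\<^sub>0 s))) (at s within I)"
      by (simp add: pd0 pdt pvt s vector_3_expansion)
    show "planar_vorticity (\<lambda>x. v x t) (planar_map (\<lambda>a. X a t) (\<gamma>\<^sub>0 s)) = 0
        \<longleftrightarrow> planar_vorticity v\<^sub>0 (\<gamma>\<^sub>0 s) = 0"
      using \<Omega> a0 at by (auto simp: pv0 pvt s vec_eq_iff forall_3)
  qed (use nz pdt at in auto)
qed

theorem theorem2p4:
  fixes T :: ereal
  assumes "0 < T"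
  shows
   "(\<forall>(v :: real^3 \<Rightarrow> real \<Rightarrow> real^3) \<rho> p v\<^sub>0 \<rho>\<^sub>0 X \<gamma>\<^sub>0 I.
       isentropic_euler_solution T v \<rho> p v\<^sub>0 \<rho>\<^sub>0 \<and>
       particle_trajectory_map T v X \<and>
       integral_curve (curl v\<^sub>0) \<gamma>\<^sub>0 I \<and>
       (\<forall>s\<in>I. \<rho>\<^sub>0 (\<gamma>\<^sub>0 s) \<noteq> 0) \<longrightarrow>
       (\<forall>t\<in>time_dom T.
          integral_curve (curl (\<lambda>x. v x t)) (\<lambda>s. X (\<gamma>\<^sub>0 s) t) I \<and>
          (\<forall>s\<in>I. vortex_ratio (curl (\<lambda>x. v x t)) (\<lambda>x. \<rho> x t) (\<lambda>s. X (\<gamma>\<^sub>0 s) t) I s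
                 = vortex_ratio (curl v\<^sub>0) \<rho>\<^sub>0 \<gamma>\<^sub>0 I s)))
    \<and>
    (\<forall>(v :: real^2 \<Rightarrow> real \<Rightarrow> real^2) \<rho> p v\<^sub>0 \<rho>\<^sub>0 X \<gamma>\<^sub>0 I.
       isentropic_euler_solution T v \<rho> p v\<^sub>0 \<rho>\<^sub>0 \<and>
       particle_trajectory_map T v X \<and>
       integral_curve (planar_vorticity v\<^sub>0) \<gamma>\<^sub>0 I \<and>
       (\<forall>s\<in>I. planar_density \<rho>\<^sub>0 (\<gamma>\<^sub>0 s) \<noteq> 0) \<longrightarrow>
       (\<forall>t\<in>time_dom T.
          integral_curve (planar_vorticity (\<lambda>x. v x t)) (\<lambda>s. planar_map (\<lambda>a. X a t) (\<gamma>\<^sub>0 s)) I \<and>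
          (\<forall>s\<in>I. vortex_ratio (planar_vorticity (\<lambda>x. v x t)) (planar_density (\<lambda>x. \<rho> x t))
                     (\<lambda>s. planar_map (\<lambda>a. X a t) (\<gamma>\<^sub>0 s)) I s
                 = vortex_ratio (planar_vorticity v\<^sub>0) (planar_density \<rho>\<^sub>0) \<gamma>\<^sub>0 I s)))"
  by (rule conjI; intro allI impI ballI; elim conjE;
      (rule spatial_invariance[OF assms] | rule planar_invariance[OF assms]); assumption)

end
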